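(* Let $(X,\|\cdot\|)$ be a Banach space with continuous dual $X'$, let $\tau$ be a locally convex topology on $X$ compatible for the pair $(X,X')$, and let $A\subseteq X$. Then the following statements are equivalent for the space $(X,\tau)$: (1) $A$ is relatively compact; (2) $A$ is relatively sequentially compact; (3) $A$ is relatively countably compact; (4) $A$ is (topologically) bounded.
   Context: A locally convex topology $\tau$ on a normed linear space $(X,\|\cdot\|)$ with continuous dual $X'$ is compatible for the pair $(X,X')$ if $(X,\tau)'=X'$ as vector spaces, where $(X,\tau)'$ is the space of $\tau$-continuous linear functionals on $X$. A subset $A$ of a topological space $Z$ is: relatively compact if its closure in $Z$ is compact; relatively sequentially compact if every sequence from $A$ has a convergent subsequence whose limit is in $Z$; relatively countably compact if each sequence of elements of $A$ has a cluster point in $Z$; (topologically) bounded if every continuous real-valued function on $Z$ is bounded on $A$ (this is not boundedness in the sense of topological vector spaces). In the theorem these notions are taken with $Z=(X,\tau)$. *)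

theory Defs
  imports "HOL-Analysis.Analysis"
begin

definition locally_convex_topology :: "'a::real_vector topology \<Rightarrow> bool" where
  "locally_convex_topology T \<longleftrightarrow>
     topspace T = UNIV \<and>
     continuous_map (prod_topology T T) T (\<lambda>(x, y). x + y) \<and>
     continuous_map (prod_topology euclideanreal T) T (\<lambda>(c, x). c *\<^sub>R x) \<and>
     neighbourhood_base_at 0 convex T"

definition continuous_dual :: "'a::real_vector topology \<Rightarrow> ('a \<Rightarrow> real) set" where
  "continuous_dual T = {f. linear f \<and> continuous_map T euclideanreal f}"

lemma continuous_dual_euclidean:
  "continuous_dual (euclidean :: 'a::real_normed_vector topology) = {f. bounded_linear f}"
proof (intro set_eqI iffI)
  fix f :: "'a \<Rightarrow> real"
  assume "f \<in> continuous_dual euclidean"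
  then have lin: "linear f" and "continuous_on UNIV f"
    by (auto simp: continuous_dual_def)
  then have "isCont f 0"
    by (simp add: continuous_on_eq_continuous_at)
  then obtain d where d: "d > 0" "\<And>x. dist x 0 < d \<Longrightarrow> dist (f x) (f 0) < 1"
    unfolding continuous_at_eps_delta by (meson zero_less_one)
  have "norm (f x) \<le> norm x * (2 / d)" for x
  proof (cases "x = 0")
    case True
    then show ?thesis by (simp add: linear_0[OF lin])
  next
    case False
    define c where "c = d / (2 * norm x)"
    have c: "c > 0" using d False by (simp add: c_def)
    have "norm (c *\<^sub>R x) < d"
      using d False by (simp add: c_def)
    then have "\<bar>f (c *\<^sub>R x)\<bar> < 1"
      using d(2)[of "c *\<^sub>R x"] by (simp add: linear_0[OF lin])
    then have "c * \<bar>f x\<bar> < 1"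
      using c by (simp add: linear_cmul[OF lin] abs_mult)
    then show ?thesis
      using False d by (simp add: c_def field_simps)
  qed
  then have "bounded_linear f"
    using bounded_linear_intro[of f "2 / d"] lin by (simp add: linear_add linear_cmul)
  then show "f \<in> {f. bounded_linear f}"
    by simp
next
  fix f :: "'a \<Rightarrow> real"
  assume "f \<in> {f. bounded_linear f}"
  then show "f \<in> continuous_dual euclidean"
    by (auto simp: continuous_dual_def linear_continuous_on bounded_linear.linear)
qed

definition compatible_topology :: "'a::real_normed_vector topology \<Rightarrow> bool" where
  "compatible_topology T \<longleftrightarrow>
     locally_convex_topology T \<and> continuous_dual T = continuous_dual euclidean"

definition relatively_compact_in :: "'a topology \<Rightarrow> 'a set \<Rightarrow> bool" where
  "relatively_compact_in Z A \<longleftrightarrow> compactin Z (Z closure_of A)"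

definition relatively_sequentially_compact_in :: "'a topology \<Rightarrow> 'a set \<Rightarrow> bool" where
  "relatively_sequentially_compact_in Z A \<longleftrightarrow>
     (\<forall>s :: nat \<Rightarrow> 'a. range s \<subseteq> A \<longrightarrow>
        (\<exists>z\<in>topspace Z. \<exists>r :: nat \<Rightarrow> nat. strict_mono r \<and> limitin Z (s \<circ> r) z sequentially))"

definition cluster_point_in :: "'a topology \<Rightarrow> (nat \<Rightarrow> 'a) \<Rightarrow> 'a \<Rightarrow> bool" where
  "cluster_point_in Z s z \<longleftrightarrow>
     z \<in> topspace Z \<and>
     (\<forall>U. openin Z U \<and> z \<in> U \<longrightarrow> (\<exists>\<^sub>F n in sequentially. s n \<in> U))"

definition relatively_countably_compact_in :: "'a topology \<Rightarrow> 'a set \<Rightarrow> bool" where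
  "relatively_countably_compact_in Z A \<longleftrightarrow>
     (\<forall>s. range s \<subseteq> A \<longrightarrow> (\<exists>z. cluster_point_in Z s z))"

(* Not von Neumann boundedness: all continuous real functions are tested, linear or not. *)
definition topologically_bounded_in :: "'a topology \<Rightarrow> 'a set \<Rightarrow> bool" where
  "topologically_bounded_in Z A \<longleftrightarrow>
     (\<forall>f. continuous_map Z euclideanreal f \<longrightarrow> bounded (f ` A))"

end

theory Submission
  imports Defs
begin

text \<open>The hard implication is that a bounded set \<open>A\<close> is relatively compact. A sequence in \<open>A\<close>
  without accumulation point for countably many continuous functions would carry an unbounded locally
  finite sum of continuous functions. Hence \<open>A\<close> is totally bounded for every continuous seminorm,
  and for any countable family of functionals each sequence in \<open>A\<close> has a cluster point in the space.
  If the closure of \<open>A\<close> in the product of all functionals contained a point \<open>\<xi>\<close> that is not an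
  evaluation, Helly's theorem would give \<open>f n\<close> in the dual unit ball and \<open>a n\<close> in \<open>A\<close> with
  \<open>f n (a k) = 0\<close> for \<open>k < n\<close>, \<open>\<xi> (f n) \<ge> d > 0\<close> and \<open>f i (a n) \<longlonglongrightarrow> \<xi> (f i)\<close>. A cluster point \<open>x\<close> of \<open>a\<close>
  for the \<open>f n\<close> and for a functional \<open>g \<le> limsup f n\<close> would satisfy both \<open>g x = 0\<close> and \<open>g x \<ge> d\<close>.
  So \<open>A\<close> is relatively weakly compact, and total boundedness makes the given topology agree with
  the weak one on the weak closure of \<open>A\<close>. Sequential compactness follows from countable compactness
  since countably many functionals separate the points of a separable closed subspace.\<close>

section \<open>The Hahn--Banach theorem\<close>

definition sublinear :: "('a::real_vector \<Rightarrow> real) \<Rightarrow> bool" where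
  "sublinear p \<longleftrightarrow>
     (\<forall>x y. p (x + y) \<le> p x + p y) \<and> (\<forall>c x. 0 \<le> c \<longrightarrow> p (c *\<^sub>R x) = c * p x)"

lemma sublinear_add: "sublinear p \<Longrightarrow> p (x + y) \<le> p x + p y"
  by (simp add: sublinear_def)

lemma sublinear_scale: "sublinear p \<Longrightarrow> 0 \<le> c \<Longrightarrow> p (c *\<^sub>R x) = c * p x"
  by (simp add: sublinear_def)

lemma sublinear_0: "sublinear p \<Longrightarrow> p 0 = 0"
  using sublinear_scale[of p 0 0] by simp

lemma sublinear_neg_le: "sublinear p \<Longrightarrow> - p (- x) \<le> p x"
  using sublinear_add[of p x "- x"] by (simp add: sublinear_0)

lemma sublinearI:
  assumes add: "\<And>x y. p (x + y) \<le> p x + p y"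
    and scale: "\<And>c x. 0 < c \<Longrightarrow> p (c *\<^sub>R x) \<le> c * p x"
    and zero: "p 0 = 0"
  shows "sublinear p"
  unfolding sublinear_def
proof (intro conjI allI impI)
  fix c :: real and x
  assume "0 \<le> c"
  show "p (c *\<^sub>R x) = c * p x"
  proof (cases "c = 0")
    case False
    with \<open>0 \<le> c\<close> have c: "0 < c" by simp
    have "p (inverse c *\<^sub>R (c *\<^sub>R x)) \<le> inverse c * p (c *\<^sub>R x)"
      using c by (intro scale) simp
    then have "c * p x \<le> p (c *\<^sub>R x)"
      using c by (simp add: field_simps)
    with scale[OF c, of x] show ?thesis by simp
  qed (simp add: zero)
qed (rule add)

lemma sublinear_norm: "sublinear norm"
  by (simp add: sublinear_def norm_triangle_ineq)

text \<open>The infimum is finite because \<open>g s \<le> p s \<le> p (x + s) + p (- x)\<close>,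
  and superadditivity of \<open>g\<close> on the cone makes \<open>q\<close> subadditive. The
  construction serves twice: for a ray with \<open>g = p\<close>, and for a subspace with
  \<open>g\<close> linear.\<close>

lemma sublinear_cone_inf:
  fixes p g :: "'a::real_vector \<Rightarrow> real"
  assumes p: "sublinear p"
    and C0: "0 \<in> C"
    and Cadd: "\<And>s t. s \<in> C \<Longrightarrow> t \<in> C \<Longrightarrow> s + t \<in> C"
    and Cscale: "\<And>c s. s \<in> C \<Longrightarrow> 0 \<le> c \<Longrightarrow> c *\<^sub>R s \<in> C"
    and gadd: "\<And>s t. s \<in> C \<Longrightarrow> t \<in> C \<Longrightarrow> g s + g t \<le> g (s + t)"
    and gscale: "\<And>c s. s \<in> C \<Longrightarrow> 0 \<le> c \<Longrightarrow> g (c *\<^sub>R s) = c * g s"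
    and gp: "\<And>s. s \<in> C \<Longrightarrow> g s \<le> p s"
  defines "q \<equiv> \<lambda>x. INF s\<in>C. p (x + s) - g s"
  shows "sublinear q" and "\<And>x s. s \<in> C \<Longrightarrow> q x \<le> p (x + s) - g s"
    and "\<And>x. q x \<le> p x" and "\<And>s. s \<in> C \<Longrightarrow> q (- s) \<le> - g s"
proof -
  have "- p (- x) \<le> p (x + s) - g s" if "s \<in> C" for x s
    using sublinear_add[OF p, of "x + s" "- x"] gp[OF that] by simp
  then have bdd: "bdd_below ((\<lambda>s. p (x + s) - g s) ` C)" for x
    by (intro bdd_belowI2)
  show le: "q x \<le> p (x + s) - g s" if "s \<in> C" for x s
    unfolding q_def by (intro cINF_lower bdd that)
  have ge: "c \<le> q x" if "\<And>s. s \<in> C \<Longrightarrow> c \<le> p (x + s) - g s" for c x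
    unfolding q_def using C0 that by (intro cINF_greatest) auto
  have g0: "g 0 = 0"
    using gscale[OF C0, of 0] by simp
  show "q x \<le> p x" for x
    using le[OF C0, of x] by (simp add: g0)
  show "q (- s) \<le> - g s" if "s \<in> C" for s
    using le[OF that, of "- s"] by (simp add: sublinear_0[OF p])
  show "sublinear q"
  proof (rule sublinearI)
    fix x y
    have "q (x + y) - (p (y + t) - g t) \<le> p (x + s) - g s" if "s \<in> C" "t \<in> C" for s t
    proof -
      have "q (x + y) \<le> p ((x + s) + (y + t)) - g (s + t)"
        using le[OF Cadd[OF that], of "x + y"] by (simp add: algebra_simps)
      also have "\<dots> \<le> p (x + s) + p (y + t) - (g s + g t)"
        using sublinear_add[OF p, of "x + s" "y + t"] gadd[OF that] by simp
      finally show ?thesis by simp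
    qed
    then have "q (x + y) - (p (y + t) - g t) \<le> q x" if "t \<in> C" for t
      using that by (intro ge)
    then have "q (x + y) - q x \<le> q y"
      by (intro ge) (simp add: algebra_simps)
    then show "q (x + y) \<le> q x + q y" by simp
  next
    fix c :: real and x
    assume c: "0 < c"
    have "q (c *\<^sub>R x) / c \<le> p (x + s) - g s" if "s \<in> C" for s
    proof -
      have "q (c *\<^sub>R x) \<le> p (c *\<^sub>R (x + s)) - g (c *\<^sub>R s)"
        using le[OF Cscale[OF that, of c], of "c *\<^sub>R x"] c by (simp add: scaleR_add_right)
      also have "\<dots> = c * (p (x + s) - g s)"
        using c by (simp add: sublinear_scale[OF p] gscale[OF that] right_diff_distrib)
      finally show ?thesis
        using c by (simp add: field_simps)
    qed
    then have "q (c *\<^sub>R x) / c \<le> q x" by (rule ge)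
    then show "q (c *\<^sub>R x) \<le> c * q x"
      using c by (simp add: field_simps)
  next
    have "q 0 \<le> 0"
      using le[OF C0, of 0] by (simp add: g0 sublinear_0[OF p])
    moreover have "0 \<le> q 0"
      using gp by (intro ge) simp
    ultimately show "q 0 = 0" by simp
  qed
qed

text \<open>On the ray through \<open>z\<close> the functional \<open>p\<close> is additive, so
  \<open>p\<close> itself can play \<open>g\<close> in \<open>sublinear_cone_inf\<close>. The third
  property makes minimal sublinear functionals additive, the fourth makes a linear minorant attain
  \<open>p z\<close>.\<close>

lemma sublinear_ray_inf:
  fixes p :: "'a::real_vector \<Rightarrow> real"
  assumes p: "sublinear p"
  obtains q where "sublinear q" and "\<And>x. q x \<le> p x" and "\<And>x. q x \<le> p (x + z) - p z"
    and "q (- z) \<le> - p z"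
proof -
  define C where "C = {t *\<^sub>R z | t. 0 \<le> t}"
  have C: "0 \<in> C" "\<And>s t. s \<in> C \<Longrightarrow> t \<in> C \<Longrightarrow> s + t \<in> C"
    "\<And>c s. s \<in> C \<Longrightarrow> 0 \<le> c \<Longrightarrow> c *\<^sub>R s \<in> C" "z \<in> C"
    unfolding C_def
    subgoal by force
    subgoal by (smt (verit) mem_Collect_eq scaleR_add_left)
    subgoal by (smt (verit) mem_Collect_eq scaleR_scaleR mult_nonneg_nonneg)
    subgoal by (force intro: exI[of _ 1])
    done
  have padd: "p s + p t \<le> p (s + t)" if "s \<in> C" "t \<in> C" for s t
    using that
    by (auto simp: C_def sublinear_scale[OF p] scaleR_add_left[symmetric] distrib_right)
  define q where "q x = (INF s\<in>C. p (x + s) - p s)" for x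
  have pscale: "p (c *\<^sub>R s) = c * p s" if "s \<in> C" "0 \<le> c" for c s
    using p that(2) by (rule sublinear_scale)
  note * = sublinear_cone_inf[of p C p, OF p C(1), folded q_def]
  show ?thesis
  proof (rule that)
    show "sublinear q" by (rule *(1)) (auto intro: C padd pscale)
    show "q x \<le> p x" for x by (rule *(3)) (auto intro: C padd pscale)
    show "q x \<le> p (x + z) - p z" for x by (rule *(2)) (auto intro: C padd pscale)
    show "q (- z) \<le> - p z" by (rule *(4)) (auto intro: C padd pscale)
  qed
qed

text \<open>A pointwise minimal sublinear functional is linear: it is not changed by
  \<open>sublinear_ray_inf\<close>, which makes it superadditive.\<close>

lemma sublinear_minorant:
  fixes p :: "'a::real_vector \<Rightarrow> real"
  assumes p: "sublinear p"
  obtains F where "linear F" and "\<And>x. F x \<le> p x"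
proof -
  define A where "A = {q. sublinear q \<and> q \<le> p}"
  \<comment> \<open>Zorn's lemma yields maximal elements, so the pointwise order is reversed to get
    a minimal one.\<close>
  define P where "P = (\<lambda>a b :: 'a \<Rightarrow> real. b \<le> a)"
  have "\<exists>m\<in>A. \<forall>a\<in>A. P m a \<longrightarrow> a = m"
  proof (rule predicate_Zorn)
    show "partial_order_on A (relation_of P A)"
      by (rule partial_order_on_relation_ofI) (auto simp: P_def)
  next
    fix C
    assume chain: "C \<in> Chains (relation_of P A)"
    then have CA: "C \<subseteq> A" and total: "\<And>a b. a \<in> C \<Longrightarrow> b \<in> C \<Longrightarrow> a \<le> b \<or> b \<le> a"
      by (auto simp: Chains_def relation_of_def P_def)
    show "\<exists>u\<in>A. \<forall>a\<in>C. P a u"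
    proof (cases "C = {}")
      case True
      with p show ?thesis by (auto simp: A_def)
    next
      case False
      have sub: "sublinear q" "q x \<le> p x" if "q \<in> C" for q x
        using that CA by (auto simp: A_def le_fun_def)
      define u where "u = (\<lambda>x. INF q\<in>C. q x)"
      have bdd: "bdd_below ((\<lambda>q. q x) ` C)" for x
      proof (rule bdd_belowI2)
        fix q
        assume "q \<in> C"
        from sublinear_neg_le[OF sub(1)[OF this], of x] sub(2)[OF this, of "- x"]
        show "- p (- x) \<le> q x" by simp
      qed
      have le: "u x \<le> q x" if "q \<in> C" for q x
        unfolding u_def by (intro cINF_lower bdd that)
      have ge: "c \<le> u x" if "\<And>q. q \<in> C \<Longrightarrow> c \<le> q x" for c x
        unfolding u_def using False that by (intro cINF_greatest)
      have "sublinear u"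
      proof (rule sublinearI)
        fix x y
        have "u (x + y) - q2 y \<le> q1 x" if q: "q1 \<in> C" "q2 \<in> C" for q1 q2
        proof -
          \<comment> \<open>The chain condition supplies one functional below both, which handles
            \<open>x\<close> and \<open>y\<close> together.\<close>
          obtain q where q: "q \<in> C" "q \<le> q1" "q \<le> q2"
            using total[OF q] q by blast
          have "u (x + y) \<le> q (x + y)" by (rule le[OF q(1)])
          also have "\<dots> \<le> q x + q y" by (rule sublinear_add[OF sub(1)[OF q(1)]])
          also have "\<dots> \<le> q1 x + q2 y" using q by (auto simp: le_fun_def intro: add_mono)
          finally show ?thesis by simp
        qed
        then have "u (x + y) - q2 y \<le> u x" if "q2 \<in> C" for q2
          using that by (intro ge)
        then have "u (x + y) - u x \<le> u y"
          by (intro ge) (simp add: algebra_simps)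
        then show "u (x + y) \<le> u x + u y" by simp
      next
        fix c :: real and x
        assume c: "0 < c"
        have "u (c *\<^sub>R x) / c \<le> q x" if "q \<in> C" for q
          using le[OF that, of "c *\<^sub>R x"] c
          by (simp add: sublinear_scale[OF sub(1)[OF that]] field_simps)
        then have "u (c *\<^sub>R x) / c \<le> u x" by (rule ge)
        then show "u (c *\<^sub>R x) \<le> c * u x"
          using c by (simp add: field_simps)
      next
        show "u 0 = 0"
          using False by (simp add: u_def sublinear_0[OF sub(1)] cong: INF_cong_simp)
      qed
      moreover have "u \<le> p"
        using False le sub(2) by (metis ex_in_conv le_funI order_trans)
      ultimately have "u \<in> A" by (simp add: A_def)
      with le show ?thesis by (auto simp: P_def le_fun_def)
    qed
  qed
  then obtain m where m: "sublinear m" "m \<le> p"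
    and min: "\<And>q. sublinear q \<Longrightarrow> q \<le> m \<Longrightarrow> q = m"
    unfolding A_def P_def by (auto intro: order_trans)
  have add: "m (x + y) = m x + m y" for x y
  proof -
    obtain q where q: "sublinear q" "\<And>x. q x \<le> m x" "\<And>x. q x \<le> m (x + y) - m y"
      using sublinear_ray_inf[OF m(1)] by metis
    have "q = m" using q(1,2) by (intro min) (simp_all add: le_fun_def)
    with q(3)[of x] sublinear_add[OF m(1), of x y] show ?thesis by simp
  qed
  have neg: "m (- x) = - m x" for x
    using add[of x "- x"] by (simp add: sublinear_0[OF m(1)])
  have "m (c *\<^sub>R x) = c * m x" for c x
    using sublinear_scale[OF m(1), of c x] sublinear_scale[OF m(1), of "- c" x] neg[of "c *\<^sub>R x"]
    by (cases "0 \<le> c") auto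
  then have "linear m"
    by (intro linearI) (simp_all add: add)
  with m(2) show ?thesis by (intro that[of m]) (simp_all add: le_fun_def)
qed

text \<open>A linear minorant of the functional lowered along \<open>z\<close> satisfies
  \<open>F (- z) \<le> - p z\<close>, hence \<open>F z \<ge> p z\<close>.\<close>

lemma Hahn_Banach_attained:
  fixes p :: "'a::real_vector \<Rightarrow> real"
  assumes "sublinear p"
  obtains F where "linear F" and "\<And>x. F x \<le> p x" and "F z = p z"
proof -
  obtain q where q: "sublinear q" "\<And>x. q x \<le> p x" "q (- z) \<le> - p z"
    using sublinear_ray_inf[OF assms] by metis
  obtain F where F: "linear F" "\<And>x. F x \<le> q x"
    using sublinear_minorant[OF q(1)] by metis
  have le: "F x \<le> p x" for x
    using F(2) q(2) order_trans by blast
  moreover have "p z \<le> F z"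
    using F(2)[of "- z"] q(3) linear_neg[OF F(1), of z] by simp
  ultimately show ?thesis
    using F(1) by (intro that[of F]) (auto intro: antisym)
qed

text \<open>A linear functional is in particular superadditive, so the cone construction applies to
  it on a subspace. For \<open>g = 0\<close> and the norm as \<open>p\<close> the infimum is the
  distance to \<open>S\<close>.\<close>

lemma sublinear_subspace_inf:
  fixes p g :: "'a::real_vector \<Rightarrow> real"
  assumes p: "sublinear p" and S: "subspace S" and g: "linear g"
    and gp: "\<forall>s\<in>S. g s \<le> p s"
  shows "sublinear (\<lambda>x. INF s\<in>S. p (x + s) - g s)"
    and "\<And>x. (INF s\<in>S. p (x + s) - g s) \<le> p x"
    and "\<And>s. s \<in> S \<Longrightarrow> (INF t\<in>S. p (- s + t) - g t) \<le> - g s"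
proof -
  note * = sublinear_cone_inf[OF p subspace_0[OF S] subspace_add[OF S] subspace_scale[OF S], of g]
  show "sublinear (\<lambda>x. INF s\<in>S. p (x + s) - g s)"
    by (rule *(1)) (auto simp: linear_add[OF g] linear_cmul[OF g] gp)
  show "(INF s\<in>S. p (x + s) - g s) \<le> p x" for x
    by (rule *(3)) (auto simp: linear_add[OF g] linear_cmul[OF g] gp)
  show "(INF t\<in>S. p (- s + t) - g t) \<le> - g s" if "s \<in> S" for s
    by (rule *(4)) (auto simp: that linear_add[OF g] linear_cmul[OF g] gp)
qed

text \<open>A linear minorant of the infimum satisfies \<open>F s \<ge> g s\<close> on
  \<open>S\<close>; the same at \<open>- s\<close> turns this into equality.\<close>

lemma Hahn_Banach_extension:
  fixes p g :: "'a::real_vector \<Rightarrow> real"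
  assumes "sublinear p" and S: "subspace S" and g: "linear g"
    and "\<forall>s\<in>S. g s \<le> p s"
  obtains F where "linear F" and "\<And>x. F x \<le> p x" and "\<And>s. s \<in> S \<Longrightarrow> F s = g s"
proof -
  note q = sublinear_subspace_inf[OF assms]
  obtain F where F: "linear F" "\<And>x. F x \<le> (INF s\<in>S. p (x + s) - g s)"
    using sublinear_minorant[OF q(1)] by metis
  have ge: "g s \<le> F s" if "s \<in> S" for s
    using F(2)[of "- s"] q(3)[OF that] linear_neg[OF F(1), of s] by simp
  have "F s = g s" if "s \<in> S" for s
    using ge[OF that] ge[OF subspace_neg[OF S that]] linear_neg[OF F(1), of s] linear_neg[OF g, of s]
    by simp
  moreover have "F x \<le> p x" for x
    using F(2) q(2) order_trans by blast
  ultimately show ?thesis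
    using F(1) by (intro that[of F])
qed

section \<open>Bounded functionals on a normed space\<close>

lemma linear_le_norm_imp_bounded:
  fixes F :: "'a::real_normed_vector \<Rightarrow> real"
  assumes "linear F" and "\<And>x. F x \<le> norm x"
  shows "bounded_linear F" and "\<bar>F x\<bar> \<le> norm x"
proof -
  show le: "\<bar>F x\<bar> \<le> norm x" for x
    using assms(2)[of x] assms(2)[of "- x"] linear_neg[OF assms(1), of x] by simp
  show "bounded_linear F"
    using assms(1) le by (intro bounded_linear_intro[of F 1]) (simp_all add: linear_add linear_cmul)
qed

lemma blinfun_of_linear_le_norm:
  fixes F :: "'a::real_normed_vector \<Rightarrow> real"
  assumes "linear F" and "\<And>x. F x \<le> norm x"
  obtains f :: "'a \<Rightarrow>\<^sub>L real" where "norm f \<le> 1" and "\<And>x. f x = F x"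
proof -
  note * = linear_le_norm_imp_bounded[OF assms]
  have "blinfun_apply (Blinfun F) x = F x" for x
    by (simp add: bounded_linear_Blinfun_apply[OF *(1)])
  then show ?thesis
    using *(2) by (intro that[of "Blinfun F"] norm_blinfun_bound) auto
qed

lemma norming_functional:
  fixes z :: "'a::real_normed_vector"
  obtains f :: "'a \<Rightarrow>\<^sub>L real" where "norm f \<le> 1" and "f z = norm z"
proof -
  obtain F where F: "linear F" "\<And>x. F x \<le> norm x" "F z = norm z"
    using Hahn_Banach_attained[OF sublinear_norm] by metis
  from blinfun_of_linear_le_norm[OF F(1,2)] F(3) show ?thesis
    using that by metis
qed

text \<open>The distance to \<open>S\<close> is sublinear, and Hahn-Banach gives a functional below
  it that attains it at \<open>z\<close>. This functional vanishes on \<open>S\<close>, so by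
  assumption it vanishes at \<open>z\<close>, and the distance is 0.\<close>

lemma subspace_approximation:
  fixes z :: "'a::real_normed_vector"
  assumes S: "subspace S" and e: "0 < e"
    and ann: "\<And>f :: 'a \<Rightarrow>\<^sub>L real. (\<And>s. s \<in> S \<Longrightarrow> f s = 0) \<Longrightarrow> f z = 0"
  obtains s where "s \<in> S" and "norm (z - s) < e"
proof -
  define q where "q x = (INF s\<in>S. norm (x + s) - 0)" for x
  have "linear (\<lambda>x::'a. 0::real)" by (simp add: linear_iff)
  note q = sublinear_subspace_inf[of norm S "\<lambda>x. 0", OF sublinear_norm S this, folded q_def, simplified]
  obtain F where F: "linear F" "\<And>x. F x \<le> q x" "F z = q z"
    using Hahn_Banach_attained[OF q(1)] by metis
  obtain f :: "'a \<Rightarrow>\<^sub>L real" where f: "\<And>x. f x = F x"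
    using blinfun_of_linear_le_norm[OF F(1)] F(2) q(2) order_trans by metis
  have ge: "0 \<le> f s" if "s \<in> S" for s
    using F(2)[of "- s"] q(3)[OF that] linear_neg[OF F(1), of s] by (simp add: f)
  have "f s = 0" if "s \<in> S" for s
    using ge[OF that] ge[OF subspace_neg[OF S that]] linear_neg[OF F(1), of s] by (simp add: f)
  then have "q z = 0"
    using ann[of f] F(3) by (simp add: f)
  then have "(INF s\<in>S. norm (z + s)) < e"
    using e by (simp add: q_def)
  then obtain s where "s \<in> S" "norm (z + s) < e"
    using cINF_less_iff[of S "\<lambda>s. norm (z + s)" e] subspace_0[OF S]
    by (metis bdd_belowI2 empty_iff norm_ge_zero)
  then show ?thesis
    using that[of "- s"] subspace_neg[OF S] by simp
qed

section \<open>Seminorms of a locally convex topology\<close>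

definition minkowski_gauge :: "'a::real_vector set \<Rightarrow> 'a \<Rightarrow> real" where
  "minkowski_gauge C x = Inf {t. 0 < t \<and> inverse t *\<^sub>R x \<in> C}"

lemma minkowski_gauge_le: "0 < t \<Longrightarrow> inverse t *\<^sub>R x \<in> C \<Longrightarrow> minkowski_gauge C x \<le> t"
  unfolding minkowski_gauge_def by (intro cInf_lower bdd_belowI[of _ 0]) auto

text \<open>Absorption keeps the infimum from being taken over the empty set. Subadditivity mixes
  two points of \<open>C\<close> with weights \<open>s / (s + t)\<close> and
  \<open>t / (s + t)\<close>; points of gauge below 1 lie in \<open>C\<close> by convexity, because
  \<open>0 \<in> C\<close>.\<close>

lemma sublinear_minkowski_gauge:
  assumes C: "convex C" and absorbing: "\<And>x. \<exists>t>0. inverse t *\<^sub>R x \<in> C"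
  shows "sublinear (minkowski_gauge C)" and "minkowski_gauge C x < 1 \<Longrightarrow> x \<in> C"
proof -
  have ge: "c \<le> minkowski_gauge C x" if "\<And>t. 0 < t \<Longrightarrow> inverse t *\<^sub>R x \<in> C \<Longrightarrow> c \<le> t" for c x
    unfolding minkowski_gauge_def using absorbing[of x] that by (intro cInf_greatest) auto
  have C0: "0 \<in> C" using absorbing[of 0] by simp
  show "sublinear (minkowski_gauge C)"
  proof (rule sublinearI)
    fix x y
    have "minkowski_gauge C (x + y) - t \<le> s"
      if "0 < s" "inverse s *\<^sub>R x \<in> C" "0 < t" "inverse t *\<^sub>R y \<in> C" for s t
    proof -
      have "(s / (s + t)) *\<^sub>R (inverse s *\<^sub>R x) + (t / (s + t)) *\<^sub>R (inverse t *\<^sub>R y) \<in> C"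
        using that by (intro convexD[OF C]) (auto simp: add_divide_distrib[symmetric])
      also have "(s / (s + t)) *\<^sub>R (inverse s *\<^sub>R x) + (t / (s + t)) *\<^sub>R (inverse t *\<^sub>R y)
          = inverse (s + t) *\<^sub>R (x + y)"
        using that by (simp add: scaleR_add_right inverse_eq_divide)
      finally show ?thesis
        using minkowski_gauge_le[of "s + t" "x + y" C] that by simp
    qed
    then have "minkowski_gauge C (x + y) - t \<le> minkowski_gauge C x"
      if "0 < t" "inverse t *\<^sub>R y \<in> C" for t
      using that by (intro ge)
    then have "minkowski_gauge C (x + y) - minkowski_gauge C x \<le> minkowski_gauge C y"
      by (intro ge) (simp add: algebra_simps)
    then show "minkowski_gauge C (x + y) \<le> minkowski_gauge C x + minkowski_gauge C y" by simp
  next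
    fix c :: real and x
    assume c: "0 < c"
    have "minkowski_gauge C (c *\<^sub>R x) / c \<le> t" if "0 < t" "inverse t *\<^sub>R x \<in> C" for t
      using minkowski_gauge_le[of "c * t" "c *\<^sub>R x" C] that c by (simp add: field_simps)
    then have "minkowski_gauge C (c *\<^sub>R x) / c \<le> minkowski_gauge C x" by (rule ge)
    then show "minkowski_gauge C (c *\<^sub>R x) \<le> c * minkowski_gauge C x"
      using c by (simp add: field_simps)
  next
    have "minkowski_gauge C 0 \<le> 0"
      by (rule dense_ge) (auto intro: minkowski_gauge_le simp: C0)
    moreover have "0 \<le> minkowski_gauge C 0" by (rule ge) simp
    ultimately show "minkowski_gauge C 0 = 0" by simp
  qed
  assume "minkowski_gauge C x < 1"
  then obtain t where t: "0 < t" "inverse t *\<^sub>R x \<in> C" "t < 1"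
    using ge[of x 1] by (meson not_le)
  have "t *\<^sub>R (inverse t *\<^sub>R x) + (1 - t) *\<^sub>R 0 \<in> C"
    using t C0 by (intro convexD[OF C]) auto
  with t show "x \<in> C" by simp
qed

section \<open>Affine maps, absorbing neighbourhoods and continuous seminorms\<close>

lemma continuous_map_affine:
  assumes T: "locally_convex_topology T"
  shows "continuous_map T T (\<lambda>x. c *\<^sub>R x + a)"
proof -
  have top: "topspace T = UNIV"
    and add: "continuous_map (prod_topology T T) T (\<lambda>(x, y). x + y)"
    and scale: "continuous_map (prod_topology euclideanreal T) T (\<lambda>(c, x). c *\<^sub>R x)"
    using T by (auto simp: locally_convex_topology_def)
  have "continuous_map T (prod_topology euclideanreal T) (\<lambda>x. (c, x))"
    by (simp add: continuous_map_paired)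
  from continuous_map_compose[OF this scale] have "continuous_map T T (\<lambda>x. c *\<^sub>R x)"
    by (simp add: o_def)
  then have "continuous_map T (prod_topology T T) (\<lambda>x. (c *\<^sub>R x, a))"
    by (simp add: continuous_map_paired top)
  from continuous_map_compose[OF this add] show ?thesis
    by (simp add: o_def)
qed

lemma openin_affine_preimage:
  assumes T: "locally_convex_topology T" and "openin T U"
  shows "openin T {x. c *\<^sub>R x + a \<in> U}"
  using openin_continuous_map_preimage[OF continuous_map_affine[OF T, of c a] assms(2)] T
  by (simp add: locally_convex_topology_def)

text \<open>For fixed \<open>x\<close> the map \<open>c *\<^sub>R x\<close> is continuous at
  \<open>c = 0\<close>, so small multiples of \<open>x\<close> fall into \<open>U\<close>.\<close>

lemma openin_absorbing:
  assumes T: "locally_convex_topology T" and U: "openin T U" "0 \<in> U"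
  shows "\<exists>t>0. inverse t *\<^sub>R x \<in> U"
proof -
  have top: "topspace T = UNIV"
    and scale: "continuous_map (prod_topology euclideanreal T) T (\<lambda>(c, x). c *\<^sub>R x)"
    using T by (auto simp: locally_convex_topology_def)
  have "continuous_map euclideanreal (prod_topology euclideanreal T) (\<lambda>c. (c, x))"
    by (simp add: continuous_map_paired top)
  from continuous_map_compose[OF this scale] have "continuous_map euclideanreal T (\<lambda>c. c *\<^sub>R x)"
    by (simp add: o_def)
  from openin_continuous_map_preimage[OF this U(1)] have "open {c. c *\<^sub>R x \<in> U}"
    by simp
  then obtain e where e: "0 < e" "\<And>c. dist c 0 < e \<Longrightarrow> c *\<^sub>R x \<in> U"
    using U(2) unfolding open_dist by (metis (mono_tags, lifting) mem_Collect_eq scale_zero_left)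
  have "inverse (inverse (e / 2)) *\<^sub>R x \<in> U"
    using e(1) by (intro e(2)) simp
  with e(1) show ?thesis by (intro exI[of _ "inverse (e / 2)"]) simp
qed

lemma continuous_map_real_diff_bound:
  assumes "\<And>x e. x \<in> topspace T \<Longrightarrow> 0 < e \<Longrightarrow>
    \<exists>U. openin T U \<and> x \<in> U \<and> (\<forall>y\<in>U. \<bar>f y - f x\<bar> < (e::real))"
  shows "continuous_map T euclideanreal f"
proof -
  have "openin T {x \<in> topspace T. f x \<in> V}" if "open V" for V
    unfolding openin_subopen[of T "{x \<in> topspace T. f x \<in> V}"]
  proof
    fix x
    assume x: "x \<in> {x \<in> topspace T. f x \<in> V}"
    with \<open>open V\<close> obtain e where e: "0 < e" "\<And>r. \<bar>r - f x\<bar> < e \<Longrightarrow> r \<in> V"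
      unfolding open_dist dist_real_def by blast
    obtain U where "openin T U" "x \<in> U" "\<forall>y\<in>U. \<bar>f y - f x\<bar> < e"
      using assms[of x e] x e(1) by auto
    with e(2) show "\<exists>U. openin T U \<and> x \<in> U \<and> U \<subseteq> {x \<in> topspace T. f x \<in> V}"
      by (intro exI[of _ U]) (auto dest: openin_subset)
  qed
  then show ?thesis by (simp add: continuous_map_def)
qed

text \<open>\<open>continuous_seminorm T p\<close> leaves out non-negativity, which follows from
  the other conditions.\<close>

definition continuous_seminorm :: "'a::real_vector topology \<Rightarrow> ('a \<Rightarrow> real) \<Rightarrow> bool" where
  "continuous_seminorm T p \<longleftrightarrow>
     sublinear p \<and> (\<forall>x. p (- x) = p x) \<and> continuous_map T euclideanreal p"

lemma continuous_seminorm_minus_commute: "continuous_seminorm T p \<Longrightarrow> p (x - y) = p (y - x)"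
  by (metis continuous_seminorm_def minus_diff_eq)

lemma continuous_seminorm_triangle:
  "continuous_seminorm T p \<Longrightarrow> p (x - z) \<le> p (x - y) + p (y - z)"
  using sublinear_add[of p "x - y" "y - z"] by (simp add: continuous_seminorm_def)

lemma continuous_map_seminorm_diff:
  assumes T: "locally_convex_topology T" and p: "continuous_seminorm T p"
  shows "continuous_map T euclideanreal (\<lambda>y. p (y - x))"
  using continuous_map_compose[OF continuous_map_affine[OF T, of 1 "- x"], of euclideanreal p] p
  by (simp add: continuous_seminorm_def o_def)

lemma openin_continuous_map_real_less:
  assumes "continuous_map T euclideanreal f" and "topspace T = UNIV"
  shows "openin T {x. f x < (c::real)}"
  using openin_continuous_map_preimage[OF assms(1), of "{..<c}"] assms(2) by simp

text \<open>The seminorm is the gauge of \<open>D\<close>, a convex neighbourhood of 0 made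
  symmetric by intersecting it with its reflection.\<close>

lemma continuous_seminorm_in_nhd_0:
  assumes T: "locally_convex_topology T" and V: "openin T V" "0 \<in> V"
  obtains p where "continuous_seminorm T p" and "\<And>x. p x < 1 \<Longrightarrow> x \<in> V"
proof -
  have "neighbourhood_base_at 0 convex T"
    using T by (simp add: locally_convex_topology_def)
  then obtain W C where W: "openin T W" "0 \<in> W" "W \<subseteq> C" and C: "convex C" "C \<subseteq> V"
    using V by (meson neighbourhood_base_at_def)
  define D where "D = C \<inter> uminus ` C"
  define B where "B = W \<inter> {x. (- 1) *\<^sub>R x + 0 \<in> W}"
  have B: "openin T B" "0 \<in> B" "B \<subseteq> D"
  proof -
    show "openin T B"
      unfolding B_def by (intro openin_Int W(1) openin_affine_preimage[OF T])
    show "0 \<in> B" using W(2) by (simp add: B_def)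
    show "B \<subseteq> D"
    proof
      fix x
      assume "x \<in> B"
      then have "x \<in> C" "- x \<in> C" using W(3) by (auto simp: B_def)
      then have "- (- x) \<in> uminus ` C" by blast
      with \<open>x \<in> C\<close> show "x \<in> D" by (simp add: D_def)
    qed
  qed
  have D: "convex D"
    unfolding D_def using C(1) by (intro convex_Int convex_negations)
  have Dneg: "- x \<in> D \<longleftrightarrow> x \<in> D" for x
    by (force simp: D_def image_iff)
  have abs: "\<exists>t>0. inverse t *\<^sub>R x \<in> D" for x
    using openin_absorbing[OF T B(1,2), of x] B(3) by auto
  define p where "p = minkowski_gauge D"
  have p: "sublinear p" "p x < 1 \<Longrightarrow> x \<in> D" for x
    using sublinear_minkowski_gauge[OF D abs] by (auto simp: p_def)
  have pneg: "p (- x) = p x" for x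
    by (simp add: p_def minkowski_gauge_def Dneg)
  have "continuous_map T euclideanreal p"
  proof (rule continuous_map_real_diff_bound)
    fix x :: 'a and e :: real
    assume e: "0 < e"
    \<comment> \<open>This is \<open>(e / 2) B\<close> translated to \<open>x\<close>; on it
      \<open>p (y - x)\<close> is at most \<open>e / 2\<close>.\<close>
    define U where "U = {y. inverse (e / 2) *\<^sub>R y + (- inverse (e / 2) *\<^sub>R x) \<in> B}"
    have "\<bar>p y - p x\<bar> < e" if "y \<in> U" for y
    proof -
      have "inverse (e / 2) *\<^sub>R (y - x) \<in> D"
        using that B(3) by (auto simp: U_def scaleR_diff_right)
      then have "p (y - x) \<le> e / 2"
        using e unfolding p_def by (intro minkowski_gauge_le) auto
      moreover have "p (x - y) = p (y - x)"
        using pneg[of "y - x"] by simp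
      ultimately show ?thesis
        using sublinear_add[OF p(1), of "y - x" x] sublinear_add[OF p(1), of "x - y" y] e by simp
    qed
    moreover have "openin T U"
      unfolding U_def by (intro openin_affine_preimage[OF T] B(1))
    moreover have "x \<in> U" using B(2) by (simp add: U_def)
    ultimately show "\<exists>U. openin T U \<and> x \<in> U \<and> (\<forall>y\<in>U. \<bar>p y - p x\<bar> < e)"
      by (intro exI[of _ U]) blast
  qed
  with p(1) pneg have "continuous_seminorm T p"
    by (simp add: continuous_seminorm_def)
  moreover have "x \<in> V" if "p x < 1" for x
    using p(2)[OF that] C(2) by (auto simp: D_def)
  ultimately show ?thesis by (rule that)
qed

lemma continuous_seminorm_in_nhd:
  assumes T: "locally_convex_topology T" and V: "openin T V" "x \<in> V"
  obtains p where "continuous_seminorm T p" and "\<And>y. p (y - x) < 1 \<Longrightarrow> y \<in> V"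
proof -
  have "openin T {y. 1 *\<^sub>R y + x \<in> V}"
    by (rule openin_affine_preimage[OF T V(1)])
  moreover have "0 \<in> {y. 1 *\<^sub>R y + x \<in> V}" using V(2) by simp
  ultimately obtain p where p: "continuous_seminorm T p" "\<And>y. p y < 1 \<Longrightarrow> y \<in> {y. 1 *\<^sub>R y + x \<in> V}"
    using continuous_seminorm_in_nhd_0[OF T] by metis
  have "y \<in> V" if "p (y - x) < 1" for y
    using p(2)[OF that] by simp
  with p(1) show ?thesis by (rule that)
qed

section \<open>Consequences of compatibility\<close>

lemma compatible_topology_locally_convex:
  "compatible_topology T \<Longrightarrow> locally_convex_topology T"
  by (simp add: compatible_topology_def)

lemma compatible_topology_topspace: "compatible_topology T \<Longrightarrow> topspace T = UNIV"
  by (simp add: compatible_topology_def locally_convex_topology_def)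

lemma compatible_topology_continuous:
  fixes f :: "'a::real_normed_vector \<Rightarrow>\<^sub>L real"
  assumes "compatible_topology T"
  shows "continuous_map T euclideanreal f"
proof -
  have "blinfun_apply f \<in> continuous_dual T"
    using assms blinfun.bounded_linear_right[of f]
    by (simp add: compatible_topology_def continuous_dual_euclidean)
  then show ?thesis by (simp add: continuous_dual_def)
qed

text \<open>Closed balls of continuous seminorms are weakly closed.\<close>

lemma compatible_seminorm_separation:
  fixes T :: "'a::real_normed_vector topology"
  assumes T: "compatible_topology T" and p: "continuous_seminorm T p"
  obtains f :: "'a \<Rightarrow>\<^sub>L real" where "\<And>x. f x \<le> p x" and "f z = p z"
proof -
  have sub: "sublinear p" and neg: "\<And>x. p (- x) = p x" and cont: "continuous_map T euclideanreal p"
    using p by (auto simp: continuous_seminorm_def)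
  have lct: "locally_convex_topology T"
    by (rule compatible_topology_locally_convex[OF T])
  obtain F where F: "linear F" "\<And>x. F x \<le> p x" "F z = p z"
    using Hahn_Banach_attained[OF sub] by metis
  have "continuous_map T euclideanreal F"
  proof (rule continuous_map_real_diff_bound)
    fix x :: 'a and e :: real
    assume e: "0 < e"
    have "\<bar>F y - F x\<bar> < e" if "p (y - x) < e" for y
      using F(2)[of "y - x"] F(2)[of "x - y"] that linear_diff[OF F(1)]
        continuous_seminorm_minus_commute[OF p, of x y] by (simp add: abs_less_iff)
    moreover have "openin T {y. p (y - x) < e}"
      by (intro openin_continuous_map_real_less continuous_map_seminorm_diff[OF lct p]
          compatible_topology_topspace[OF T])
    ultimately show "\<exists>U. openin T U \<and> x \<in> U \<and> (\<forall>y\<in>U. \<bar>F y - F x\<bar> < e)"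
      using e by (intro exI[of _ "{y. p (y - x) < e}"]) (auto simp: sublinear_0[OF sub])
  qed
  with F(1) have "F \<in> continuous_dual T"
    by (simp add: continuous_dual_def)
  \<comment> \<open>Compatibility enters here: continuity for \<open>T\<close> becomes boundedness
    for the norm.\<close>
  then have "bounded_linear F"
    using T by (simp add: compatible_topology_def continuous_dual_euclidean)
  then have "blinfun_apply (Blinfun F) x = F x" for x
    by (simp add: bounded_linear_Blinfun_apply)
  with F show ?thesis by (intro that[of "Blinfun F"]) auto
qed

section \<open>Accumulation in topologically bounded sets\<close>

text \<open>Otherwise \<open>\<Sum>k. k max 0 (1 - k D k)\<close> would be a locally finite sum of continuous functions,
  with a value of at least \<open>k\<close> at \<open>s k\<close>.\<close>

lemma topologically_bounded_imp_accumulation: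
  assumes A: "topologically_bounded_in T A" and top: "A \<subseteq> topspace T" and s: "range s \<subseteq> A"
    and D: "\<And>k. continuous_map T euclideanreal (D k)"
    and D0: "\<And>k. D k (s k) = (0::real)"
  shows "\<exists>x\<in>topspace T. \<forall>U e. openin T U \<longrightarrow> x \<in> U \<longrightarrow> 0 < e \<longrightarrow>
      (\<exists>\<^sub>F k in sequentially. \<exists>y\<in>U. D k y < e)"
proof (rule ccontr)
  assume "\<not> ?thesis"
  then have far: "\<exists>U e. openin T U \<and> x \<in> U \<and> 0 < e \<and> (\<forall>\<^sub>F k in sequentially. \<forall>y\<in>U. e \<le> D k y)"
    if "x \<in> topspace T" for x
    using that by (simp add: frequently_def not_less)
  \<comment> \<open>\<open>\<phi> k\<close> is supported where \<open>D k < 1 / k\<close> and has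
    value \<open>k\<close> at \<open>s k\<close>. A neighbourhood on which eventually
    \<open>D k \<ge> e\<close> meets only finitely many of these supports.\<close>
  define \<phi> where "\<phi> k y = real k * max 0 (1 - real k * D k y)" for k y
  define h where "h y = (\<Sum>k. \<phi> k y)" for y
  have nonneg: "0 \<le> \<phi> k y" for k y
    by (simp add: \<phi>_def)
  have locfin: "\<exists>U N. openin T U \<and> x \<in> U \<and> (\<forall>y\<in>U. \<forall>k\<ge>N. \<phi> k y = 0)" if "x \<in> topspace T" for x
  proof -
    obtain U e where U: "openin T U" "x \<in> U" "0 < e" "\<forall>\<^sub>F k in sequentially. \<forall>y\<in>U. e \<le> D k y"
      using far[OF \<open>x \<in> topspace T\<close>] by blast
    then obtain N1 where N1: "\<And>k y. k \<ge> N1 \<Longrightarrow> y \<in> U \<Longrightarrow> e \<le> D k y"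
      by (auto simp: eventually_sequentially)
    obtain N2 where N2: "1 / e < real N2"
      using reals_Archimedean2 by blast
    have "\<phi> k y = 0" if "y \<in> U" "k \<ge> max N1 N2" for k y
    proof -
      have "1 \<le> real k * e"
      proof -
        have "1 / e \<le> real k" using N2 that(2) by (simp add: max_def split: if_splits)
        then show ?thesis using U(3) by (simp add: field_simps)
      qed
      also have "\<dots> \<le> real k * D k y"
        using N1[of k y] that by (intro mult_left_mono) auto
      finally show ?thesis by (simp add: \<phi>_def)
    qed
    with U(1,2) show ?thesis by blast
  qed
  have h_eq: "h y = (\<Sum>k<N. \<phi> k y)" if "\<forall>k\<ge>N. \<phi> k y = 0" for y N
    unfolding h_def using that by (intro suminf_finite) auto
  have "continuous_map T euclideanreal h"
  proof (rule continuous_map_real_diff_bound)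
    fix x and e :: real
    assume x: "x \<in> topspace T" and e: "0 < e"
    obtain U N where U: "openin T U" "x \<in> U" "\<forall>y\<in>U. \<forall>k\<ge>N. \<phi> k y = 0"
      using locfin[OF x] by blast
    define H where "H y = (\<Sum>k<N. \<phi> k y)" for y
    have "continuous_map T euclideanreal H"
      unfolding H_def \<phi>_def
      by (intro continuous_map_sum continuous_map_real_mult continuous_map_real_max
          continuous_map_diff continuous_map_canonical_const D) auto
    from openin_continuous_map_preimage[OF this, of "ball (H x) e"]
    have "openin T (U \<inter> {y \<in> topspace T. H y \<in> ball (H x) e})"
      using U(1) by (intro openin_Int) auto
    moreover have "\<bar>h y - h x\<bar> < e" if "y \<in> U \<inter> {y \<in> topspace T. H y \<in> ball (H x) e}" for y
      using that U(2,3) h_eq[of N y] h_eq[of N x] by (auto simp: H_def dist_real_def)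
    ultimately show "\<exists>U. openin T U \<and> x \<in> U \<and> (\<forall>y\<in>U. \<bar>h y - h x\<bar> < e)"
      using U(2) x e by (intro exI[of _ "U \<inter> {y \<in> topspace T. H y \<in> ball (H x) e}"]) auto
  qed
  with A have "bounded (h ` A)"
    by (simp add: topologically_bounded_in_def)
  then obtain B where B: "\<And>a. a \<in> A \<Longrightarrow> \<bar>h a\<bar> \<le> B"
    by (auto simp: bounded_iff)
  obtain k where k: "B < real k" using reals_Archimedean2 by blast
  have sk: "s k \<in> A" using s by auto
  obtain N where N: "\<forall>j\<ge>N. \<phi> j (s k) = 0"
    using locfin[of "s k"] sk top by blast
  have "real k = \<phi> k (s k)" by (simp add: \<phi>_def D0)
  \<comment> \<open>The summation range contains the index \<open>k\<close> as well as every index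
    with a nonzero term.\<close>
  also have "\<dots> \<le> (\<Sum>j<max N (Suc k). \<phi> j (s k))"
    by (rule member_le_sum) (auto simp: nonneg)
  also have "\<dots> = h (s k)"
    using N by (intro h_eq[symmetric]) auto
  also have "\<dots> \<le> B" using B[OF sk] by simp
  finally show False using k by simp
qed

text \<open>\<open>D k\<close> adds up the first \<open>k\<close> differences from
  \<open>a k\<close>, so an accumulation point of the \<open>D k\<close> handles countably many
  functionals with one point \<open>x\<close>.\<close>

lemma topologically_bounded_functional_cluster:
  fixes T :: "'a::real_normed_vector topology" and f :: "nat \<Rightarrow> 'a \<Rightarrow>\<^sub>L real"
  assumes T: "compatible_topology T" and A: "topologically_bounded_in T A" and a: "range a \<subseteq> A"
  obtains x where "\<And>n e. 0 < e \<Longrightarrow> \<exists>\<^sub>F k in sequentially. \<forall>i<n. \<bar>f i (a k) - f i x\<bar> < e"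
proof -
  have top: "topspace T = UNIV"
    by (rule compatible_topology_topspace[OF T])
  define D where "D k y = (\<Sum>i<k. \<bar>f i y - f i (a k)\<bar>)" for k y
  have cont: "continuous_map T euclideanreal (\<lambda>y. \<Sum>i<n. \<bar>f i y - f i z\<bar>)" for n z
    by (intro continuous_map_sum continuous_map_real_abs continuous_map_diff
        continuous_map_canonical_const compatible_topology_continuous[OF T]) auto
  have topA: "A \<subseteq> topspace T" and D0: "\<And>k. D k (a k) = 0"
    by (simp_all add: top D_def)
  have contD: "continuous_map T euclideanreal (D k)" for k
    unfolding D_def by (rule cont)
  obtain x where x: "\<forall>U e. openin T U \<longrightarrow> x \<in> U \<longrightarrow> 0 < e \<longrightarrow>
      (\<exists>\<^sub>F k in sequentially. \<exists>y\<in>U. D k y < e)"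
    using topologically_bounded_imp_accumulation[OF A topA a contD D0] by blast
  have "\<exists>\<^sub>F k in sequentially. \<forall>i<n. \<bar>f i (a k) - f i x\<bar> < e" if e: "0 < e" for n e
  proof -
    define U where "U = {y. (\<Sum>i<n. \<bar>f i y - f i x\<bar>) < e / 2}"
    have "openin T U"
      unfolding U_def by (intro openin_continuous_map_real_less cont top)
    moreover have "x \<in> U" using e by (simp add: U_def)
    ultimately have "\<exists>\<^sub>F k in sequentially. \<exists>y\<in>U. D k y < e / 2"
      using e by (intro x[rule_format]) auto
    \<comment> \<open>Once \<open>n \<le> k\<close>, the sum \<open>D k\<close> contains the first
      \<open>n\<close> functionals.\<close>
    then have "\<exists>\<^sub>F k in sequentially. (\<exists>y\<in>U. D k y < e / 2) \<and> n \<le> k"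
      using eventually_ge_at_top by (rule frequently_eventually_frequently)
    then show ?thesis
    proof (rule frequently_elim1, elim conjE bexE, intro allI impI)
      fix k y i
      assume y: "y \<in> U" "D k y < e / 2" and "n \<le> k" "i < n"
      have "\<bar>f i y - f i (a k)\<bar> \<le> D k y"
        unfolding D_def using \<open>i < n\<close> \<open>n \<le> k\<close>
        by (intro member_le_sum[where f = "\<lambda>i. \<bar>f i y - f i (a k)\<bar>"]) auto
      moreover have "\<bar>f i y - f i x\<bar> \<le> (\<Sum>i<n. \<bar>f i y - f i x\<bar>)"
        using \<open>i < n\<close> by (intro member_le_sum[where f = "\<lambda>i. \<bar>f i y - f i x\<bar>"]) auto
      ultimately show "\<bar>f i (a k) - f i x\<bar> < e"
        using y by (auto simp: U_def)
    qed
  qed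
  then show ?thesis by (rule that)
qed

text \<open>Failure yields an \<open>e\<close>-separated sequence in \<open>A\<close>. The functions
  \<open>p (y - s k)\<close> accumulate at some \<open>x\<close>, which then has
  \<open>p\<close>-distance below \<open>e / 2\<close> to two different members, against the
  separation.\<close>

lemma topologically_bounded_totally_bounded:
  assumes T: "locally_convex_topology T" and A: "topologically_bounded_in T A"
    and p: "continuous_seminorm T p" and e: "0 < e"
  shows "\<exists>F. finite F \<and> F \<subseteq> A \<and> (\<forall>a\<in>A. \<exists>b\<in>F. p (a - b) < e)"
proof (rule ccontr)
  assume "\<not> ?thesis"
  then have no: "\<not> (\<forall>a\<in>A. \<exists>b\<in>F. p (a - b) < e)" if "finite F" "F \<subseteq> A" for F
    using that by blast
  have "\<exists>s. \<forall>n::nat. s n \<in> A \<and> (\<forall>k<n. e \<le> p (s n - s k))"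
  proof (rule dependent_wellorder_choice)
    fix n :: nat and s
    assume s: "\<And>m. m < n \<Longrightarrow> s m \<in> A \<and> (\<forall>k<m. e \<le> p (s m - s k))"
    have "finite (s ` {..<n})" "s ` {..<n} \<subseteq> A" using s by auto
    from no[OF this] show "\<exists>r. r \<in> A \<and> (\<forall>k<n. e \<le> p (r - s k))"
      by (auto simp: not_less)
  qed auto
  then obtain s :: "nat \<Rightarrow> 'a" where s: "\<And>n. s n \<in> A" "\<And>k n. k < n \<Longrightarrow> e \<le> p (s n - s k)" by metis
  have top: "topspace T = UNIV" using T by (simp add: locally_convex_topology_def)
  have p0: "p 0 = 0" using p by (simp add: continuous_seminorm_def sublinear_0)
  have topA: "A \<subseteq> topspace T" and sA: "range s \<subseteq> A" and D0: "\<And>k. p (s k - s k) = 0"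
    using top s(1) by (auto simp: p0)
  obtain x where x: "\<forall>U e. openin T U \<longrightarrow> x \<in> U \<longrightarrow> 0 < e \<longrightarrow>
      (\<exists>\<^sub>F k in sequentially. \<exists>y\<in>U. p (y - s k) < e)"
    using topologically_bounded_imp_accumulation[where D = "\<lambda>k y. p (y - s k)",
        OF A topA sA continuous_map_seminorm_diff[OF T p] D0] by blast
  define U where "U = {y. p (y - x) < e / 4}"
  have "openin T U"
    unfolding U_def by (intro openin_continuous_map_real_less continuous_map_seminorm_diff[OF T p] top)
  moreover have "x \<in> U" using e by (simp add: U_def p0)
  ultimately have freq: "\<exists>\<^sub>F k in sequentially. \<exists>y\<in>U. p (y - s k) < e / 4"
    using e by (intro x[rule_format]) auto
  have near: "p (s k - x) < e / 2" if "y \<in> U" "p (y - s k) < e / 4" for y k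
    using that continuous_seminorm_triangle[OF p, of "s k" x y]
      continuous_seminorm_minus_commute[OF p, of y "s k"] by (simp add: U_def)
  obtain k where k: "p (s k - x) < e / 2"
    using frequently_ex[OF freq] near by blast
  have "\<exists>n\<ge>Suc k. \<exists>y\<in>U. p (y - s n) < e / 4"
    using freq unfolding frequently_sequentially by blast
  then obtain n where n: "k < n" "p (s n - x) < e / 2"
    using near by (auto simp: Suc_le_eq)
  have "p (s n - s k) < e"
    using k n(2) continuous_seminorm_triangle[OF p, of "s n" "s k" x]
      continuous_seminorm_minus_commute[OF p, of x "s k"] by simp
  with s(2)[OF n(1)] show False by simp
qed

section \<open>Weak closures of topologically bounded sets\<close>

text \<open>If \<open>a\<close> imposes a condition not implied by those of \<open>F\<close>, some
  \<open>f0\<close> vanishes on \<open>F\<close> and is 1 at \<open>a\<close>; subtracting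
  \<open>\<Lambda> f0\<close> times the evaluation at \<open>a\<close> reduces the claim to
  \<open>F\<close>.\<close>

lemma linear_vanishing_on_annihilator:
  fixes \<Lambda> :: "('a::real_normed_vector \<Rightarrow>\<^sub>L real) \<Rightarrow> real"
  assumes "finite F" and "linear \<Lambda>"
    and "\<And>f. (\<And>a. a \<in> F \<Longrightarrow> blinfun_apply f a = 0) \<Longrightarrow> \<Lambda> f = 0"
  shows "\<exists>y. \<forall>f. \<Lambda> f = f y"
  using assms
proof (induction F arbitrary: \<Lambda> rule: finite_induct)
  case empty
  then show ?case by (intro exI[of _ 0]) (auto simp: blinfun.zero_right)
next
  case (insert a F)
  show ?case
  proof (cases "\<forall>f :: 'a \<Rightarrow>\<^sub>L real. (\<forall>b\<in>F. f b = 0) \<longrightarrow> f a = 0")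
    case True
    then show ?thesis
      using insert.prems by (intro insert.IH) auto
  next
    case False
    then obtain f1 :: "'a \<Rightarrow>\<^sub>L real" where f1: "\<And>b. b \<in> F \<Longrightarrow> f1 b = 0" "f1 a \<noteq> 0" by blast
    define f0 where "f0 = inverse (f1 a) *\<^sub>R f1"
    have f0: "\<And>b. b \<in> F \<Longrightarrow> f0 b = 0" "f0 a = 1"
      using f1 by (auto simp: f0_def blinfun.scaleR_left)
    have lin: "linear \<Lambda>" by fact
    define \<Lambda>' where "\<Lambda>' f = \<Lambda> f - f a * \<Lambda> f0" for f
    have "linear \<Lambda>'"
      by (rule linearI) (auto simp: \<Lambda>'_def linear_add[OF lin] linear_cmul[OF lin]
          blinfun.add_left blinfun.scaleR_left algebra_simps)
    moreover have "\<Lambda>' f = 0" if "\<And>b. b \<in> F \<Longrightarrow> blinfun_apply f b = 0" for f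
    proof -
      have "\<Lambda> (f - f a *\<^sub>R f0) = 0"
        using that f0 by (intro insert.prems(2)) (auto simp: blinfun.diff_left blinfun.scaleR_left)
      then show ?thesis
        by (simp add: \<Lambda>'_def linear_diff[OF lin] linear_cmul[OF lin])
    qed
    ultimately obtain y where y: "\<And>f. \<Lambda>' f = f y"
      using insert.IH by blast
    have "\<Lambda> f = f (y + \<Lambda> f0 *\<^sub>R a)" for f
      using y[of f] by (simp add: \<Lambda>'_def blinfun.add_right blinfun.scaleR_right algebra_simps)
    then show ?thesis by blast
  qed
qed

text \<open>On the annihilator of \<open>F\<close> the functional \<open>\<xi>\<close> is dominated
  by \<open>d * norm f\<close>. Hahn-Banach extends it from there to \<open>\<eta>\<close> with the
  same bound, and \<open>\<xi> - \<eta>\<close> kills the annihilator, so it is evaluation at a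
  point.\<close>

lemma functional_near_evaluation:
  fixes \<xi> :: "('a::real_normed_vector \<Rightarrow>\<^sub>L real) \<Rightarrow> real"
  assumes lin: "linear \<xi>" and F: "finite F" and d: "0 < d"
    and small: "\<And>f. norm f \<le> 1 \<Longrightarrow> (\<And>a. a \<in> F \<Longrightarrow> blinfun_apply f a = 0) \<Longrightarrow> \<xi> f < d"
  obtains y where "\<And>f. \<bar>\<xi> f - f y\<bar> \<le> d * norm f"
proof -
  define S where "S = {f :: 'a \<Rightarrow>\<^sub>L real. \<forall>a\<in>F. f a = 0}"
  have S: "subspace S"
    by (auto simp: S_def subspace_def blinfun.add_left blinfun.scaleR_left)
  have p: "sublinear (\<lambda>f :: 'a \<Rightarrow>\<^sub>L real. d * norm f)"
    using d by (intro sublinearI) (auto simp: distrib_left[symmetric] norm_triangle_ineq)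
  have "\<xi> f \<le> d * norm f" if "f \<in> S" for f
  proof (cases "f = 0")
    case True
    then show ?thesis by (simp add: linear_0[OF lin])
  next
    case False
    have "\<xi> (inverse (norm f) *\<^sub>R f) < d"
      using that False by (intro small) (auto simp: S_def blinfun.scaleR_left)
    then show ?thesis
      using False by (simp add: linear_cmul[OF lin] field_simps)
  qed
  then obtain \<eta> where \<eta>: "linear \<eta>" "\<And>f. \<eta> f \<le> d * norm f" "\<And>f. f \<in> S \<Longrightarrow> \<eta> f = \<xi> f"
    using Hahn_Banach_extension[OF p S lin] by metis
  have "\<exists>y. \<forall>f. \<xi> f - \<eta> f = f y"
    using F by (rule linear_vanishing_on_annihilator)
      (auto simp: linear_compose_sub lin \<eta>(1) \<eta>(3) S_def)
  then obtain y where y: "\<And>f. \<xi> f - \<eta> f = f y" by blast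
  have "\<bar>\<xi> f - f y\<bar> \<le> d * norm f" for f
    using y[of f] \<eta>(2)[of f] \<eta>(2)[of "- f"] linear_neg[OF \<eta>(1), of f] by simp
  then show ?thesis by (rule that)
qed

text \<open>Failing this for every \<open>d\<close> means, by Helly's theorem, that \<open>\<xi>\<close> is a limit of
  evaluations in the norm of the bidual; \<open>'a\<close> being complete, it is then an evaluation.\<close>

lemma not_evaluation_imp_separating_functionals:
  fixes \<xi> :: "('a::banach \<Rightarrow>\<^sub>L real) \<Rightarrow> real"
  assumes lin: "linear \<xi>" and not_eval: "\<not> (\<exists>x. \<forall>f. \<xi> f = f x)"
  obtains d where "0 < d"
    and "\<And>F. finite F \<Longrightarrow> \<exists>f. norm f \<le> 1 \<and> (\<forall>a\<in>F. blinfun_apply f a = 0) \<and> d \<le> \<xi> f"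
proof (rule ccontr)
  note thesisI = that
  assume no: "\<not> thesis"
  have near: "\<exists>y. \<forall>f. \<bar>\<xi> f - f y\<bar> \<le> d * norm f" if d: "0 < d" for d
  proof -
    obtain F where "finite F"
      "\<And>f. norm f \<le> 1 \<Longrightarrow> (\<And>a. a \<in> F \<Longrightarrow> blinfun_apply f a = 0) \<Longrightarrow> \<xi> f < d"
      using thesisI[OF d] no by (meson not_le)
    from functional_near_evaluation[OF lin this(1) d this(2)] show ?thesis by metis
  qed
  have "\<exists>y. \<forall>m f. \<bar>\<xi> f - f (y m)\<bar> \<le> inverse (real (Suc m)) * norm f"
    using near[of "inverse (real (Suc m))" for m] by (intro choice) simp
  then obtain y where y: "\<And>m f. \<bar>\<xi> f - f (y m)\<bar> \<le> inverse (real (Suc m)) * norm f" by blast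
  have dist: "norm (y m - y l) \<le> inverse (real (Suc m)) + inverse (real (Suc l))" for m l
  proof -
    \<comment> \<open>A norming functional turns the estimates on the dual into a Cauchy estimate in
      the space.\<close>
    obtain f :: "'a \<Rightarrow>\<^sub>L real" where f: "norm f \<le> 1" "f (y m - y l) = norm (y m - y l)"
      using norming_functional by metis
    have "\<bar>\<xi> f - f (y m)\<bar> \<le> inverse (real (Suc m))" for m
      using f(1) by (intro order_trans[OF y] mult_left_le) auto
    from this[of m] this[of l] f(2) show ?thesis
      by (simp add: blinfun.diff_right)
  qed
  have lim0: "(\<lambda>m. inverse (real (Suc m))) \<longlonglongrightarrow> 0"
    by (rule LIMSEQ_inverse_real_of_nat)
  have "Cauchy y"
  proof (rule metric_CauchyI)
    fix e :: real
    assume "0 < e"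
    then have "\<forall>\<^sub>F m in sequentially. inverse (real (Suc m)) < e / 2"
      by (intro order_tendstoD(2)[OF lim0]) simp
    then obtain M where M: "\<And>m. M \<le> m \<Longrightarrow> inverse (real (Suc m)) < e / 2"
      by (auto simp: eventually_sequentially)
    have "dist (y m) (y n) < e" if "M \<le> m" "M \<le> n" for m n
      using dist[of m n] M[OF that(1)] M[OF that(2)] by (simp add: dist_norm)
    then show "\<exists>M. \<forall>m\<ge>M. \<forall>n\<ge>M. dist (y m) (y n) < e" by blast
  qed
  then obtain x where x: "y \<longlonglongrightarrow> x"
    by (auto simp: Cauchy_convergent_iff convergent_def)
  have "\<xi> f = f x" for f
  proof -
    have "(\<lambda>m. \<xi> f - f (y m)) \<longlonglongrightarrow> 0"
    proof (rule Lim_null_comparison)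
      show "\<forall>\<^sub>F m in sequentially. norm (\<xi> f - f (y m)) \<le> inverse (real (Suc m)) * norm f"
        using y by simp
      show "(\<lambda>m. inverse (real (Suc m)) * norm f) \<longlonglongrightarrow> 0"
        using tendsto_mult_left_zero[OF lim0] .
    qed
    moreover have "(\<lambda>m. \<xi> f - f (y m)) \<longlonglongrightarrow> \<xi> f - f x"
      by (intro tendsto_intros x)
    ultimately show ?thesis
      using LIMSEQ_unique by fastforce
  qed
  with not_eval show False by blast
qed

text \<open>A substitute for a weak* cluster point of the \<open>f n\<close>: their upper limit
  \<open>p\<close> is sublinear and below the norm, and any linear minorant of it will do.\<close>

lemma functional_below_limsup:
  fixes f :: "nat \<Rightarrow> 'a::real_normed_vector \<Rightarrow>\<^sub>L real"
  assumes f: "\<And>n. norm (f n) \<le> 1"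
  obtains g :: "'a \<Rightarrow>\<^sub>L real"
  where "\<And>x c. (\<forall>\<^sub>F n in sequentially. f n x \<le> c) \<Longrightarrow> g x \<le> c"
proof -
  have bound: "\<bar>f n x\<bar> \<le> norm x" for n x
    using norm_blinfun[of "f n" x] mult_right_mono[OF f[of n] norm_ge_zero[of x]] by simp
  \<comment> \<open>The upper limit of \<open>f n x\<close>, as the infimum of its eventual upper
    bounds; \<open>bound\<close> makes this set nonempty and bounded below.\<close>
  define p where "p x = Inf {c. \<forall>\<^sub>F n in sequentially. f n x \<le> c}" for x
  have le: "p x \<le> c" if "\<forall>\<^sub>F n in sequentially. f n x \<le> c" for x c
    unfolding p_def
  proof (rule cInf_lower)
    show "bdd_below {c. \<forall>\<^sub>F n in sequentially. f n x \<le> c}"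
    proof (rule bdd_belowI)
      fix c
      assume "c \<in> {c. \<forall>\<^sub>F n in sequentially. f n x \<le> c}"
      then obtain n where "f n x \<le> c" by (auto simp: eventually_sequentially)
      with bound[of n x] show "- norm x \<le> c" by simp
    qed
  qed (simp add: that)
  have ge: "d \<le> p x" if "\<And>c. \<forall>\<^sub>F n in sequentially. f n x \<le> c \<Longrightarrow> d \<le> c" for d x
    unfolding p_def
  proof (rule cInf_greatest)
    have "f n x \<le> norm x" for n using bound[of n x] by simp
    then have "norm x \<in> {c. \<forall>\<^sub>F n in sequentially. f n x \<le> c}" by simp
    then show "{c. \<forall>\<^sub>F n in sequentially. f n x \<le> c} \<noteq> {}" by blast
  qed (simp add: that)
  have "sublinear p"
  proof (rule sublinearI)
    fix x y
    have "p (x + y) - d \<le> c"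
      if "\<forall>\<^sub>F n in sequentially. f n x \<le> c" "\<forall>\<^sub>F n in sequentially. f n y \<le> d" for c d
    proof -
      have "p (x + y) \<le> c + d"
        by (intro le eventually_elim2[OF that]) (simp add: blinfun.add_right)
      then show ?thesis by simp
    qed
    then have "p (x + y) - d \<le> p x" if "\<forall>\<^sub>F n in sequentially. f n y \<le> d" for d
      using that by (intro ge)
    then have "p (x + y) - p x \<le> p y"
      by (intro ge) (simp add: algebra_simps)
    then show "p (x + y) \<le> p x + p y" by simp
  next
    fix c :: real and x
    assume c: "0 < c"
    have "p (c *\<^sub>R x) / c \<le> d" if "\<forall>\<^sub>F n in sequentially. f n x \<le> d" for d
    proof -
      have "p (c *\<^sub>R x) \<le> c * d"
        using c by (intro le eventually_mono[OF that]) (simp add: blinfun.scaleR_right)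
      then show ?thesis using c by (simp add: field_simps)
    qed
    then have "p (c *\<^sub>R x) / c \<le> p x" by (rule ge)
    then show "p (c *\<^sub>R x) \<le> c * p x"
      using c by (simp add: field_simps)
  next
    have "p 0 \<le> 0" by (intro le) (simp add: blinfun.zero_right)
    moreover have "0 \<le> p 0" by (intro ge) (simp add: blinfun.zero_right)
    ultimately show "p 0 = 0" by simp
  qed
  then obtain F where F: "linear F" "\<And>x. F x \<le> p x"
    using sublinear_minorant by metis
  have "p x \<le> norm x" for x
    using bound by (intro le always_eventually allI) (simp add: abs_le_iff)
  with F obtain g :: "'a \<Rightarrow>\<^sub>L real" where g: "\<And>x. g x = F x"
    using blinfun_of_linear_le_norm[of F] by (metis order_trans)
  have "g x \<le> c" if "\<forall>\<^sub>F n in sequentially. f n x \<le> c" for x c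
    using F(2)[of x] le[OF that] by (simp add: g)
  then show ?thesis by (rule that)
qed

text \<open>The canonical map into the bidual, but with values in plain functions: the closure in
  their product topology contains all pointwise limits without presupposing linearity or
  continuity.\<close>

definition evaluation :: "'a::real_normed_vector \<Rightarrow> ('a \<Rightarrow>\<^sub>L real) \<Rightarrow> real" where
  [simp]: "evaluation x f = f x"

section \<open>Closures of evaluations in the product of all functionals\<close>

lemma closure_meets_open:
  assumes "\<xi> \<in> closure S" and "open N" and "\<xi> \<in> N"
  obtains \<eta> where "\<eta> \<in> S" and "\<eta> \<in> N"
  using assms open_Int_closure_eq_empty[of N S] by blast

lemma open_coordinate_greater: "open {\<eta> :: 'b \<Rightarrow> real. c < \<eta> f}"
  by (intro open_Collect_less continuous_on_const continuous_on_product_coordinates)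

lemma closure_coordinates_approx:
  fixes S :: "('b \<Rightarrow> real) set"
  assumes \<xi>: "\<xi> \<in> closure S" and F: "finite F" and e: "0 < e"
  obtains \<eta> where "\<eta> \<in> S" and "\<And>f. f \<in> F \<Longrightarrow> \<bar>\<eta> f - \<xi> f\<bar> < e"
proof -
  define N where "N = (\<Inter>f\<in>F. {\<eta> :: 'b \<Rightarrow> real. \<bar>\<eta> f - \<xi> f\<bar> < e})"
  have "open N"
    unfolding N_def using F
    by (intro open_INT ballI open_Collect_less continuous_intros continuous_on_product_coordinates)
  moreover have "\<xi> \<in> N" using e by (simp add: N_def)
  ultimately obtain \<eta> where "\<eta> \<in> S" "\<eta> \<in> N"
    using closure_meets_open[OF \<xi>] by metis
  then show ?thesis by (intro that[of \<eta>]) (auto simp: N_def)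
qed

text \<open>Each linear identity involves finitely many coordinates, on which \<open>\<xi>\<close>
  is approximated by evaluations, and these are linear.\<close>

lemma linear_in_closure_evaluations:
  fixes A :: "'a::real_normed_vector set"
  assumes \<xi>: "\<xi> \<in> closure (evaluation ` A)"
  shows "linear (\<xi> :: ('a \<Rightarrow>\<^sub>L real) \<Rightarrow> real)"
proof (rule linearI)
  fix f g :: "'a \<Rightarrow>\<^sub>L real"
  have "\<bar>\<xi> (f + g) - (\<xi> f + \<xi> g)\<bar> \<le> e" if e: "0 < e" for e
  proof -
    obtain \<eta> where \<eta>: "\<eta> \<in> evaluation ` A"
      "\<And>h. h \<in> {f, g, f + g} \<Longrightarrow> \<bar>\<eta> h - \<xi> h\<bar> < e / 3"
      using closure_coordinates_approx[OF \<xi>, of "{f, g, f + g}" "e / 3"] e by auto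
    have "\<eta> (f + g) = \<eta> f + \<eta> g"
      using \<eta>(1) by (auto simp: blinfun.add_left)
    moreover have "\<bar>\<eta> f - \<xi> f\<bar> < e / 3" "\<bar>\<eta> g - \<xi> g\<bar> < e / 3" "\<bar>\<eta> (f + g) - \<xi> (f + g)\<bar> < e / 3"
      by (rule \<eta>(2), simp)+
    ultimately show ?thesis by linarith
  qed
  then show "\<xi> (f + g) = \<xi> f + \<xi> g"
    using dense_ge[of 0 "\<bar>\<xi> (f + g) - (\<xi> f + \<xi> g)\<bar>"] by simp
next
  fix c :: real and f :: "'a \<Rightarrow>\<^sub>L real"
  have "\<bar>\<xi> (c *\<^sub>R f) - c * \<xi> f\<bar> \<le> e" if e: "0 < e" for e
  proof -
    \<comment> \<open>The error will be bounded by \<open>\<bar>c\<bar> * d + d\<close>, which this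
      choice makes equal to \<open>e\<close>.\<close>
    define d where "d = e / (1 + \<bar>c\<bar>)"
    have "0 < d" using e by (simp add: d_def)
    then obtain \<eta> where \<eta>: "\<eta> \<in> evaluation ` A"
      "\<And>h. h \<in> {f, c *\<^sub>R f} \<Longrightarrow> \<bar>\<eta> h - \<xi> h\<bar> < d"
      using closure_coordinates_approx[OF \<xi>, of "{f, c *\<^sub>R f}" d] by auto
    have "\<bar>\<xi> (c *\<^sub>R f) - c * \<xi> f\<bar> = \<bar>c * (\<eta> f - \<xi> f) - (\<eta> (c *\<^sub>R f) - \<xi> (c *\<^sub>R f))\<bar>"
      using \<eta>(1) by (auto simp: blinfun.scaleR_left algebra_simps)
    also have "\<dots> \<le> \<bar>c\<bar> * \<bar>\<eta> f - \<xi> f\<bar> + \<bar>\<eta> (c *\<^sub>R f) - \<xi> (c *\<^sub>R f)\<bar>"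
      by (metis abs_mult abs_triangle_ineq4)
    also have "\<dots> \<le> \<bar>c\<bar> * d + d"
      using \<eta>(2)[of f] \<eta>(2)[of "c *\<^sub>R f"] by (intro add_mono mult_left_mono) auto
    also have "\<dots> = d * (1 + \<bar>c\<bar>)"
      by (simp add: algebra_simps)
    also have "\<dots> = e"
      using abs_ge_zero[of c] unfolding d_def by (intro nonzero_eq_divide_eq[THEN iffD1]) auto
    finally show ?thesis .
  qed
  then show "\<xi> (c *\<^sub>R f) = c *\<^sub>R \<xi> f"
    using dense_ge[of 0 "\<bar>\<xi> (c *\<^sub>R f) - c * \<xi> f\<bar>"] by simp
qed

text \<open>This is where boundedness forces pointwise limits, a priori only linear forms on the
  dual, back into the space.\<close>

lemma closure_evaluations_is_evaluation:
  fixes T :: "'a::banach topology" and \<xi> :: "('a \<Rightarrow>\<^sub>L real) \<Rightarrow> real"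
  assumes T: "compatible_topology T" and A: "topologically_bounded_in T A"
    and \<xi>: "\<xi> \<in> closure (evaluation ` A)"
  shows "\<exists>x. \<forall>f. \<xi> f = f x"
proof (rule ccontr)
  assume not_eval: "\<not> ?thesis"
  obtain d where d: "0 < d"
    and sep: "\<And>F. finite F \<Longrightarrow> \<exists>f. norm f \<le> 1 \<and> (\<forall>a\<in>F. blinfun_apply f a = 0) \<and> d \<le> \<xi> f"
    using not_evaluation_imp_separating_functionals[OF linear_in_closure_evaluations[OF \<xi>] not_eval]
    by metis
  \<comment> \<open>\<open>fst (s n)\<close> annihilates the points chosen before it, and
    \<open>snd (s n)\<close> matches \<open>\<xi>\<close> on the functionals chosen before it. Both
    ranges are strict, so each stage meets finitely many conditions on earlier data only.\<close>
  have "\<exists>s :: nat \<Rightarrow> ('a \<Rightarrow>\<^sub>L real) \<times> 'a. \<forall>n. norm (fst (s n)) \<le> 1 \<and>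
      (\<forall>k<n. blinfun_apply (fst (s n)) (snd (s k)) = 0) \<and> d \<le> \<xi> (fst (s n)) \<and> snd (s n) \<in> A \<and>
      (\<forall>i<n. \<bar>blinfun_apply (fst (s i)) (snd (s n)) - \<xi> (fst (s i))\<bar> < inverse (real (Suc n)))"
  proof (rule dependent_wellorder_choice)
    fix n :: nat and s :: "nat \<Rightarrow> ('a \<Rightarrow>\<^sub>L real) \<times> 'a"
    have "finite ((\<lambda>k. snd (s k)) ` {..<n})" by simp
    from sep[OF this] obtain f where
      f: "norm f \<le> 1" "\<forall>k<n. blinfun_apply f (snd (s k)) = 0" "d \<le> \<xi> f" by auto
    obtain \<eta> where "\<eta> \<in> evaluation ` A"
      and "\<And>f. f \<in> (\<lambda>i. fst (s i)) ` {..<n} \<Longrightarrow> \<bar>\<eta> f - \<xi> f\<bar> < inverse (real (Suc n))"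
      using closure_coordinates_approx[OF \<xi>, of "(\<lambda>i. fst (s i)) ` {..<n}" "inverse (real (Suc n))"]
      by auto
    then obtain a where "a \<in> A"
      "\<forall>i<n. \<bar>blinfun_apply (fst (s i)) a - \<xi> (fst (s i))\<bar> < inverse (real (Suc n))" by auto
    with f show "\<exists>r. norm (fst r) \<le> 1 \<and> (\<forall>k<n. blinfun_apply (fst r) (snd (s k)) = 0) \<and> d \<le> \<xi> (fst r) \<and>
        snd r \<in> A \<and> (\<forall>i<n. \<bar>blinfun_apply (fst (s i)) (snd r) - \<xi> (fst (s i))\<bar> < inverse (real (Suc n)))"
      by (intro exI[of _ "(f, a)"]) simp
  qed auto
  then obtain s :: "nat \<Rightarrow> ('a \<Rightarrow>\<^sub>L real) \<times> 'a" where s: "\<And>n. norm (fst (s n)) \<le> 1"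
      "\<And>k n. k < n \<Longrightarrow> blinfun_apply (fst (s n)) (snd (s k)) = 0" "\<And>n. d \<le> \<xi> (fst (s n))" "\<And>n. snd (s n) \<in> A"
      "\<And>i n. i < n \<Longrightarrow> \<bar>blinfun_apply (fst (s i)) (snd (s n)) - \<xi> (fst (s i))\<bar> < inverse (real (Suc n))"
    by metis
  define f where "f n = fst (s n)" for n
  define a where "a n = snd (s n)" for n
  note s' = s[folded f_def a_def]
  obtain g :: "'a \<Rightarrow>\<^sub>L real" where g: "\<And>x c. (\<forall>\<^sub>F n in sequentially. f n x \<le> c) \<Longrightarrow> g x \<le> c"
    using functional_below_limsup[of f] s'(1) by metis
  have "g (a k) = 0" for k
  proof -
    have ev: "\<forall>\<^sub>F n in sequentially. f n (a k) = 0"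
      using s'(2)[of k] by (auto simp: eventually_at_top_dense)
    have "g (a k) \<le> 0" by (rule g) (rule eventually_mono[OF ev], simp)
    moreover have "g (- a k) \<le> 0"
      by (rule g) (rule eventually_mono[OF ev], simp add: blinfun.minus_right)
    ultimately show ?thesis by (simp add: blinfun.minus_right)
  qed
  \<comment> \<open>Prepending \<open>g\<close> with \<open>case_nat\<close> yields one
    \<open>x\<close> for \<open>g\<close> and all \<open>f n\<close> together; \<open>f i\<close>
    moves to position \<open>Suc i\<close>, hence the bound \<open>Suc (Suc i)\<close> further
    on.\<close>
  obtain x where x: "\<And>n e. 0 < e \<Longrightarrow>
      \<exists>\<^sub>F k in sequentially. \<forall>i<n. \<bar>case_nat g f i (a k) - case_nat g f i x\<bar> < e"
    using topologically_bounded_functional_cluster[OF T A, of a "case_nat g f"] s'(4) by blast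
  have "\<exists>\<^sub>F k in sequentially. \<bar>g (a k) - g x\<bar> < d"
    using x[OF d, of 1] by simp
  then have gx: "\<bar>g x\<bar> < d"
    using \<open>\<And>k. g (a k) = 0\<close> by (simp add: frequently_const_iff)
  \<comment> \<open>\<open>f i (a k)\<close> returns arbitrarily close to \<open>f i x\<close> and
    converges to \<open>\<xi> (f i)\<close>, so the two values agree and are at least
    \<open>d\<close>.\<close>
  have "d \<le> f i x" for i
  proof -
    have "\<bar>\<xi> (f i) - f i x\<bar> \<le> e" if e: "0 < e" for e
    proof -
      have "\<exists>\<^sub>F k in sequentially. \<bar>f i (a k) - f i x\<bar> < e / 2"
        by (rule frequently_elim1[OF x[of "e / 2" "Suc (Suc i)"]]) (use e in force)+
      moreover have "\<forall>\<^sub>F k in sequentially. \<bar>f i (a k) - \<xi> (f i)\<bar> < e / 2"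
      proof -
        have "\<forall>\<^sub>F k in sequentially. inverse (real (Suc k)) < e / 2"
          using e by (intro order_tendstoD(2)[OF LIMSEQ_inverse_real_of_nat]) simp
        then show ?thesis
          using eventually_gt_at_top[of i] by eventually_elim (use s'(5)[of i] in force)
      qed
      ultimately obtain k where "\<bar>f i (a k) - f i x\<bar> < e / 2" "\<bar>f i (a k) - \<xi> (f i)\<bar> < e / 2"
        by (metis (mono_tags, lifting) frequently_eventually_frequently frequently_ex)
      then show ?thesis by linarith
    qed
    then have "\<xi> (f i) = f i x"
      using dense_ge[of 0 "\<bar>\<xi> (f i) - f i x\<bar>"] by simp
    with s'(3)[of i] show ?thesis by simp
  qed
  \<comment> \<open>An upper bound for all \<open>f n\<close> at \<open>- x\<close> passes to
    \<open>g\<close>, which amounts to \<open>g x \<ge> d\<close>.\<close>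
  then have "g (- x) \<le> - d"
    by (intro g always_eventually) (simp add: blinfun.minus_right)
  with gx show False by (simp add: blinfun.minus_right)
qed

text \<open>Tychonoff's theorem: boundedness under each functional puts the evaluations into a
  product of compact intervals, which is also closed.\<close>

lemma compact_closure_evaluations:
  fixes A :: "'a::real_normed_vector set"
  assumes "\<And>f :: 'a \<Rightarrow>\<^sub>L real. bounded (f ` A)"
  shows "compact (closure (evaluation ` A))"
proof -
  have "\<exists>M :: ('a \<Rightarrow>\<^sub>L real) \<Rightarrow> real. \<forall>f. \<forall>a\<in>A. \<bar>blinfun_apply f a\<bar> \<le> M f"
    using assms by (intro choice) (auto simp: bounded_iff)
  then obtain M :: "('a \<Rightarrow>\<^sub>L real) \<Rightarrow> real" where M: "\<And>f a. a \<in> A \<Longrightarrow> \<bar>blinfun_apply f a\<bar> \<le> M f" by blast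
  define B where "B = (\<Pi>\<^sub>E f \<in> (UNIV :: ('a \<Rightarrow>\<^sub>L real) set). {- M f .. M f})"
  have "compactin (product_topology (\<lambda>_. euclideanreal) UNIV) B"
    unfolding B_def by (simp add: compactin_PiE)
  then have B: "compact B"
    by (simp add: euclidean_product_topology)
  have "closed B"
    unfolding B_def closed_closedin euclidean_product_topology[symmetric]
    by (simp add: closedin_product_topology)
  moreover have "evaluation ` A \<subseteq> B"
    using M by (auto simp: B_def PiE_iff abs_le_iff minus_le_iff)
  ultimately have "closure (evaluation ` A) \<subseteq> B"
    by (simp add: closure_minimal)
  with B show ?thesis
    using compact_Int_closed[OF B closed_closure] by (metis Int_absorb1)
qed

text \<open>A functional below \<open>p\<close> that attains it at \<open>z - b\<close> gives an
  open half-space containing \<open>z\<close> and missing the closed \<open>p\<close>-ball of radius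
  \<open>r\<close> about \<open>b\<close>. Finitely many such half-spaces are intersected.\<close>

lemma seminorm_ball_complement_nhd:
  fixes T :: "'a::real_normed_vector topology"
  assumes T: "compatible_topology T" and p: "continuous_seminorm T p" and F: "finite F"
  obtains N :: "(('a \<Rightarrow>\<^sub>L real) \<Rightarrow> real) set" where "open N" and "evaluation z \<in> N"
    and "\<And>y b. evaluation y \<in> N \<Longrightarrow> b \<in> F \<Longrightarrow> r < p (z - b) \<Longrightarrow> r < p (y - b)"
proof -
  have "\<exists>g :: 'a \<Rightarrow> 'a \<Rightarrow>\<^sub>L real. \<forall>b. (\<forall>x. g b x \<le> p x) \<and> g b (z - b) = p (z - b)"
    by (intro choice allI) (metis compatible_seminorm_separation[OF T p])
  then obtain g :: "'a \<Rightarrow> 'a \<Rightarrow>\<^sub>L real" where g: "\<And>b x. g b x \<le> p x" "\<And>b. g b (z - b) = p (z - b)"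
    by blast
  define N where "N = (\<Inter>b\<in>{b\<in>F. r < p (z - b)}. {\<eta> :: ('a \<Rightarrow>\<^sub>L real) \<Rightarrow> real. r + g b b < \<eta> (g b)})"
  show ?thesis
  proof (rule that[of N])
    show "open N"
      unfolding N_def using F by (intro open_INT ballI open_coordinate_greater) auto
    have "r + g b b < g b z" if "r < p (z - b)" for b
      using that g(2)[of b] by (simp add: blinfun.diff_right)
    then show "evaluation z \<in> N" by (simp add: N_def)
    show "r < p (y - b)" if "evaluation y \<in> N" "b \<in> F" "r < p (z - b)" for y b
    proof -
      have "r + g b b < g b y" using that by (simp add: N_def)
      then show ?thesis using g(1)[of b "y - b"] by (simp add: blinfun.diff_right)
    qed
  qed
qed

text \<open>The inverse of the embedding of \<open>'a\<close> into the product of its functionals is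
  continuous on the weak closure of \<open>A\<close>: finitely many small balls cover \<open>A\<close>, they cover
  its weak closure because they are weakly closed, and those among them that miss \<open>x\<close>
  have a weak neighbourhood of \<open>x\<close> as complement.\<close>

lemma topologically_bounded_imp_relatively_compact:
  fixes T :: "'a::banach topology"
  assumes T: "compatible_topology T" and A: "topologically_bounded_in T A"
  shows "relatively_compact_in T A"
proof -
  have top: "topspace T = UNIV" by (rule compatible_topology_topspace[OF T])
  have lct: "locally_convex_topology T" by (rule compatible_topology_locally_convex[OF T])
  define K where "K = closure (evaluation ` A)"
  have "compact K"
    unfolding K_def using A compatible_topology_continuous[OF T]
    by (intro compact_closure_evaluations) (auto simp: topologically_bounded_in_def)
  have E_inj: "x = y" if "evaluation x = evaluation y" for x y :: 'a
  proof -
    obtain f :: "'a \<Rightarrow>\<^sub>L real" where f: "f (x - y) = norm (x - y)"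
      using norming_functional by metis
    have "f x = f y" using fun_cong[OF that, of f] by simp
    with f show ?thesis by (simp add: blinfun.diff_right)
  qed
  \<comment> \<open>\<open>\<psi>\<close> inverts the embedding; on \<open>K\<close> it is a
    two-sided inverse because every point of \<open>K\<close> is an evaluation.\<close>
  define \<psi> :: "(('a \<Rightarrow>\<^sub>L real) \<Rightarrow> real) \<Rightarrow> 'a" where "\<psi> = inv evaluation"
  have psi_eval: "\<psi> (evaluation x) = x" for x
    unfolding \<psi>_def by (intro inv_f_f injI E_inj)
  have eval_psi: "evaluation (\<psi> \<xi>) = \<xi>" if "\<xi> \<in> K" for \<xi>
  proof -
    obtain x where "\<forall>f. \<xi> f = f x"
      using closure_evaluations_is_evaluation[OF T A] \<open>\<xi> \<in> K\<close> unfolding K_def by blast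
    then have "\<xi> = evaluation x" by auto
    then show ?thesis by (simp add: psi_eval)
  qed
  have "continuous_map (top_of_set K) T \<psi>"
    unfolding continuous_map_def
  proof (intro conjI allI impI)
    fix V
    assume V: "openin T V"
    show "openin (top_of_set K) {\<xi> \<in> topspace (top_of_set K). \<psi> \<xi> \<in> V}"
      unfolding openin_subopen[of _ "{\<xi> \<in> topspace (top_of_set K). \<psi> \<xi> \<in> V}"]
    proof
      fix \<xi>
      assume "\<xi> \<in> {\<xi> \<in> topspace (top_of_set K). \<psi> \<xi> \<in> V}"
      then have \<xi>: "\<xi> \<in> K" "\<psi> \<xi> \<in> V" by auto
      define x where "x = \<psi> \<xi>"
      have Ex: "evaluation x = \<xi>" using eval_psi[OF \<xi>(1)] by (simp add: x_def)
      obtain p where p: "continuous_seminorm T p" "\<And>y. p (y - x) < 1 \<Longrightarrow> y \<in> V"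
        using continuous_seminorm_in_nhd[OF lct V] \<xi>(2) unfolding x_def by metis
      have "\<exists>F. finite F \<and> F \<subseteq> A \<and> (\<forall>a\<in>A. \<exists>b\<in>F. p (a - b) < 1 / 4)"
        by (rule topologically_bounded_totally_bounded[OF lct A p(1)]) simp
      then obtain F where F: "finite F" "\<forall>a\<in>A. \<exists>b\<in>F. p (a - b) < 1 / 4"
        by blast
      \<comment> \<open>A point outside all the balls would have a weak neighbourhood outside all of
        them, but such a neighbourhood meets \<open>A\<close>.\<close>
      have cover: "\<exists>b\<in>F. p (y - b) \<le> 1 / 4" if "evaluation y \<in> K" for y
      proof (rule ccontr)
        assume no: "\<not> ?thesis"
        obtain N where N: "open N" "evaluation y \<in> N"
          "\<And>a b. evaluation a \<in> N \<Longrightarrow> b \<in> F \<Longrightarrow> 1 / 4 < p (y - b) \<Longrightarrow> 1 / 4 < p (a - b)"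
          using seminorm_ball_complement_nhd[OF T p(1) F(1), of y "1 / 4"] by metis
        obtain a where a: "a \<in> A" "evaluation a \<in> N"
          using closure_meets_open[OF _ N(1,2)] \<open>evaluation y \<in> K\<close> unfolding K_def by blast
        obtain b where "b \<in> F" "p (a - b) < 1 / 4"
          using F(2) a(1) by blast
        with N(3)[OF a(2), of b] no show False by force
      qed
      obtain N where N: "open N" "evaluation x \<in> N"
        "\<And>y b. evaluation y \<in> N \<Longrightarrow> b \<in> F \<Longrightarrow> 1 / 4 < p (x - b) \<Longrightarrow> 1 / 4 < p (y - b)"
        using seminorm_ball_complement_nhd[OF T p(1) F(1), of x "1 / 4"] by metis
      have "\<psi> \<eta> \<in> V" if "\<eta> \<in> K" "\<eta> \<in> N" for \<eta>
      proof (rule p(2))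
        have eval_eta: "evaluation (\<psi> \<eta>) = \<eta>" by (rule eval_psi[OF that(1)])
        \<comment> \<open>A ball containing \<open>\<psi> \<eta>\<close> cannot be one that misses
          \<open>x\<close>, so both points lie in it and have \<open>p\<close>-distance at most
          \<open>1 / 2\<close>.\<close>
        obtain b where b: "b \<in> F" "p (\<psi> \<eta> - b) \<le> 1 / 4"
          using cover[of "\<psi> \<eta>"] \<open>\<eta> \<in> K\<close> unfolding eval_eta by blast
        then have "p (x - b) \<le> 1 / 4"
          using N(3)[of "\<psi> \<eta>" b] \<open>\<eta> \<in> N\<close> unfolding eval_eta by (meson not_le)
        with b(2) show "p (\<psi> \<eta> - x) < 1"
          using continuous_seminorm_triangle[OF p(1), of "\<psi> \<eta>" x b]
            continuous_seminorm_minus_commute[OF p(1), of b x] by simp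
      qed
      with \<xi>(1) N(1,2) show "\<exists>U. openin (top_of_set K) U \<and> \<xi> \<in> U \<and>
          U \<subseteq> {\<xi> \<in> topspace (top_of_set K). \<psi> \<xi> \<in> V}"
        by (intro exI[of _ "K \<inter> N"]) (auto simp: Ex openin_open_Int)
    qed
  qed (simp add: top)
  moreover have "compactin (top_of_set K) K"
    using \<open>compact K\<close> by (simp add: compactin_subtopology)
  ultimately have comp: "compactin T (\<psi> ` K)"
    by (rule image_compactin[rotated])
  \<comment> \<open>The image of \<open>K\<close> must also be closed in order to contain the
    closure of \<open>A\<close>; it is the preimage of the closed set \<open>K\<close> under the
    embedding.\<close>
  have "continuous_map T euclidean evaluation"
    unfolding euclidean_product_topology[symmetric]
    by (simp add: continuous_map_componentwise_UNIV compatible_topology_continuous[OF T])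
  from closedin_continuous_map_preimage[OF this, of K]
  have "closedin T {x. evaluation x \<in> K}" by (simp add: K_def top)
  also have "{x. evaluation x \<in> K} = \<psi> ` K"
  proof (intro equalityI subsetI)
    show "x \<in> \<psi> ` K" if "x \<in> {x. evaluation x \<in> K}" for x
      using that by (intro image_eqI[of _ _ "evaluation x"]) (simp_all only: psi_eval mem_Collect_eq)
    show "x \<in> {x. evaluation x \<in> K}" if "x \<in> \<psi> ` K" for x
      using that eval_psi by auto
  qed
  finally have closed: "closedin T (\<psi> ` K)" .
  have "A \<subseteq> \<psi> ` K"
  proof
    fix a
    assume "a \<in> A"
    then have "evaluation a \<in> K"
      unfolding K_def by (intro subsetD[OF closure_subset] imageI)
    then have "\<psi> (evaluation a) \<in> \<psi> ` K" by (rule imageI)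
    then show "a \<in> \<psi> ` K" by (simp only: psi_eval)
  qed
  then have "T closure_of A \<subseteq> \<psi> ` K"
    by (intro closure_of_minimal closed)
  with comp show ?thesis
    unfolding relatively_compact_in_def by (intro closed_compactin[OF comp]) auto
qed

section \<open>Countable and sequential compactness\<close>

lemma cluster_point_continuous_map:
  assumes "cluster_point_in T u z" and "continuous_map T euclideanreal f" and "0 < e"
  shows "\<exists>\<^sub>F n in sequentially. \<bar>f (u n) - f z\<bar> < e"
proof -
  have z: "z \<in> topspace T"
    and cl: "\<And>U. openin T U \<Longrightarrow> z \<in> U \<Longrightarrow> \<exists>\<^sub>F n in sequentially. u n \<in> U"
    using assms(1) by (auto simp: cluster_point_in_def)
  have "\<exists>\<^sub>F n in sequentially. u n \<in> {x \<in> topspace T. f x \<in> ball (f z) e}"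
    using assms(2,3) z by (intro cl openin_continuous_map_preimage) auto
  then show ?thesis
    by (rule frequently_elim1) (auto simp: dist_real_def)
qed

lemma relatively_compact_imp_countably_compact:
  assumes A: "relatively_compact_in Z A" and top: "A \<subseteq> topspace Z"
  shows "relatively_countably_compact_in Z A"
  unfolding relatively_countably_compact_in_def
proof (intro allI impI)
  fix s :: "nat \<Rightarrow> 'a"
  assume s: "range s \<subseteq> A"
  show "\<exists>z. cluster_point_in Z s z"
  proof (rule ccontr)
    assume no: "\<not> ?thesis"
    \<comment> \<open>Without a cluster point, the open sets that the sequence eventually avoids
      would cover the closure, and a finite subcover would be avoided all at once.\<close>
    define \<U> where "\<U> = {U. openin Z U \<and> (\<forall>\<^sub>F n in sequentially. s n \<notin> U)}"
    have comp: "compactin Z (Z closure_of A)"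
      using A by (simp add: relatively_compact_in_def)
    have "Z closure_of A \<subseteq> \<Union>\<U>"
    proof
      fix z
      assume "z \<in> Z closure_of A"
      then have "z \<in> topspace Z" using closure_of_subset_topspace[of Z A] by blast
      with no obtain U where "openin Z U" "z \<in> U" "\<not> (\<exists>\<^sub>F n in sequentially. s n \<in> U)"
        by (auto simp: cluster_point_in_def)
      then show "z \<in> \<Union>\<U>" by (auto simp: \<U>_def not_frequently)
    qed
    then obtain \<F> where \<F>: "finite \<F>" "\<F> \<subseteq> \<U>" "Z closure_of A \<subseteq> \<Union>\<F>"
      using comp unfolding compactin_def \<U>_def by (metis (mono_tags, lifting) mem_Collect_eq)
    have "\<forall>\<^sub>F n in sequentially. \<forall>U\<in>\<F>. s n \<notin> U"
      using \<F>(1,2) by (intro eventually_ball_finite) (auto simp: \<U>_def)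
    then obtain n where "s n \<notin> \<Union>\<F>"
      by (auto simp: eventually_sequentially)
    moreover have "s n \<in> Z closure_of A"
      using s closure_of_subset[OF top] by auto
    ultimately show False using \<F>(3) by blast
  qed
qed

lemma relatively_sequentially_compact_imp_countably_compact:
  assumes A: "relatively_sequentially_compact_in Z A"
  shows "relatively_countably_compact_in Z A"
  unfolding relatively_countably_compact_in_def
proof (intro allI impI)
  fix s :: "nat \<Rightarrow> 'a"
  assume "range s \<subseteq> A"
  with A obtain z r where z: "z \<in> topspace Z" and r: "strict_mono r" and lim: "limitin Z (s \<circ> r) z sequentially"
    unfolding relatively_sequentially_compact_in_def by blast
  have "\<exists>\<^sub>F n in sequentially. s n \<in> U" if U: "openin Z U" "z \<in> U" for U
  proof -
    obtain N where N: "\<And>n. n \<ge> N \<Longrightarrow> s (r n) \<in> U"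
      using lim U by (auto simp: limitin_def eventually_sequentially)
    show ?thesis
      unfolding frequently_sequentially
    proof
      fix n
      have "max N n \<le> r (max N n)" by (rule strict_mono_imp_increasing[OF r])
      with N[of "max N n"] show "\<exists>m\<ge>n. s m \<in> U"
        by (intro exI[of _ "r (max N n)"]) auto
    qed
  qed
  with z show "\<exists>z. cluster_point_in Z s z" by (auto simp: cluster_point_in_def)
qed

lemma relatively_countably_compact_imp_topologically_bounded:
  assumes A: "relatively_countably_compact_in Z A"
  shows "topologically_bounded_in Z A"
  unfolding topologically_bounded_in_def
proof (intro allI impI, rule ccontr)
  fix f
  assume f: "continuous_map Z euclideanreal f" and "\<not> bounded (f ` A)"
  then have "\<exists>a\<in>A. real n < \<bar>f a\<bar>" for n
    by (auto simp: bounded_iff not_le)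
  then obtain s where s: "\<And>n. s n \<in> A" "\<And>n. real n < \<bar>f (s n)\<bar>" by metis
  obtain z where z: "cluster_point_in Z s z"
    using A s(1) unfolding relatively_countably_compact_in_def by blast
  obtain N where N: "\<bar>f z\<bar> + 1 < real N"
    using reals_Archimedean2 by blast
  obtain n where n: "N \<le> n" "\<bar>f (s n) - f z\<bar> < 1"
    using cluster_point_continuous_map[OF z f zero_less_one] by (auto simp: frequently_sequentially)
  from n(1) have "real N \<le> real n" by simp
  with n(2) N s(2)[of n] show False by simp
qed

text \<open>Norming functionals of the rational combinations of the \<open>s k\<close> suffice,
  since these combinations are countable in number and dense in the span.\<close>

lemma countable_separating_functionals:
  fixes s :: "nat \<Rightarrow> 'a::real_normed_vector"
  obtains f :: "nat \<Rightarrow> 'a \<Rightarrow>\<^sub>L real"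
  where "\<And>z. (\<And>e. 0 < e \<Longrightarrow> \<exists>y\<in>span (range s). norm (z - y) < e) \<Longrightarrow> (\<And>i. f i z = 0) \<Longrightarrow> z = 0"
proof -
  \<comment> \<open>A rational combination is coded by a list of pairs, a countable type that
    \<open>from_nat\<close> enumerates.\<close>
  define v where "v l = (\<Sum>(q, k)\<leftarrow>l. real_of_rat q *\<^sub>R s k)" for l
  have dense: "\<forall>e>0. \<exists>l. norm (y - v l) < e" if "y \<in> span (range s)" for y
    using that
  proof (induction rule: span_induct_alt)
    case base
    have "v [] = 0" by (simp add: v_def)
    then show ?case by (intro allI impI exI[of _ "[]"]) simp
  next
    case (step c x y)
    from step(1) obtain k where x: "x = s k" by blast
    show ?case
    proof (intro allI impI)
      fix e :: real
      assume e: "0 < e"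
      with step(2) obtain l where l: "norm (y - v l) < e / 2"
        by (meson half_gt_zero)
      define d where "d = e / 2 / (1 + norm (s k))"
      have n: "0 < 1 + norm (s k)" using norm_ge_zero[of "s k"] by linarith
      have d: "0 < d" using e n by (simp add: d_def)
      obtain q where q: "c < real_of_rat q" "real_of_rat q < c + d"
        using of_rat_dense[of c "c + d"] d by auto
      have "v ((q, k) # l) = real_of_rat q *\<^sub>R s k + v l"
        by (simp add: v_def)
      then have "c *\<^sub>R x + y - v ((q, k) # l) = (c - real_of_rat q) *\<^sub>R s k + (y - v l)"
        by (simp add: x scaleR_diff_left)
      also have "norm \<dots> \<le> \<bar>c - real_of_rat q\<bar> * norm (s k) + norm (y - v l)"
        by (rule norm_triangle_le) simp
      also have "\<dots> < e"
      proof -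
        have "\<bar>c - real_of_rat q\<bar> * norm (s k) \<le> d * (1 + norm (s k))"
          using q d by (intro mult_mono) auto
        also have "\<dots> = e / 2" using n by (simp add: d_def del: divide_divide_eq_left)
        finally show ?thesis using l by simp
      qed
      finally show "\<exists>l. norm (c *\<^sub>R x + y - v l) < e" by blast
    qed
  qed
  have "\<exists>f :: (rat \<times> nat) list \<Rightarrow> 'a \<Rightarrow>\<^sub>L real. \<forall>l. norm (f l) \<le> 1 \<and> blinfun_apply (f l) (v l) = norm (v l)"
    by (intro choice allI) (metis norming_functional)
  then obtain f :: "(rat \<times> nat) list \<Rightarrow> 'a \<Rightarrow>\<^sub>L real"
    where f: "\<And>l. norm (f l) \<le> 1" "\<And>l. f l (v l) = norm (v l)" by blast
  show ?thesis
  proof (rule that[of "\<lambda>i. f (from_nat i)"])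
    fix z
    assume z: "\<And>e. 0 < e \<Longrightarrow> \<exists>y\<in>span (range s). norm (z - y) < e"
      and "\<And>i. f (from_nat i) z = 0"
    then have fz: "f l z = 0" for l by (metis from_nat_to_nat)
    have "norm z \<le> e" if e: "0 < e" for e
    proof -
      obtain y where y: "y \<in> span (range s)" "norm (z - y) < e / 4"
        using z[of "e / 4"] e by auto
      obtain l where l: "norm (y - v l) < e / 4"
        using dense[OF y(1)] e by (meson zero_less_divide_iff zero_less_numeral)
      have near: "norm (z - v l) < e / 2"
        using norm_triangle_ineq[of "z - y" "y - v l"] y(2) l by simp
      \<comment> \<open>Since \<open>f l\<close> is norming at \<open>v l\<close> and kills
        \<open>z\<close>, the norm of \<open>v l\<close> is at most its distance to
        \<open>z\<close>.\<close>
      have "norm (v l) = \<bar>f l (z - v l)\<bar>"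
        by (simp add: blinfun.diff_right fz f(2))
      also have "\<dots> \<le> norm (f l) * norm (z - v l)"
        using norm_blinfun[of "f l" "z - v l"] by simp
      also have "\<dots> \<le> norm (z - v l)"
        using f(1)[of l] by (intro mult_left_le_one_le) auto
      finally show ?thesis
        using norm_triangle_ineq[of "z - v l" "v l"] near by simp
    qed
    then show "z = 0"
      using dense_ge[of 0 "norm z"] by simp
  qed
qed

text \<open>Functionals that vanish on \<open>S\<close> also vanish at \<open>z\<close>, so by
  Hahn-Banach \<open>z\<close> belongs to the norm closure of \<open>S\<close>.\<close>

lemma cluster_point_near_span:
  fixes T :: "'a::real_normed_vector topology"
  assumes T: "compatible_topology T" and z: "cluster_point_in T u z" and u: "range u \<subseteq> S"
    and S: "subspace S" and e: "0 < e"
  shows "\<exists>y\<in>S. norm (z - y) < e"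
proof -
  have "f z = 0" if f: "\<And>s. s \<in> S \<Longrightarrow> f s = 0" for f :: "'a \<Rightarrow>\<^sub>L real"
  proof -
    have fu: "f (u n) = 0" for n using u f by blast
    have "\<bar>f z\<bar> \<le> d" if "0 < d" for d
      using frequently_ex[OF cluster_point_continuous_map[OF z compatible_topology_continuous[OF T, of f] that]]
      by (auto simp: fu)
    then show ?thesis using dense_ge[of 0 "\<bar>f z\<bar>"] by simp
  qed
  with subspace_approximation[OF S e, of z] show ?thesis by metis
qed

text \<open>Along some subsequence, countably many functionals converge to their values at a cluster
  point \<open>z\<close>. A cluster point of any further subsequence has the same values and lies in
  the closed span, where these functionals separate points, so it equals \<open>z\<close>.\<close>

lemma relatively_countably_compact_imp_sequentially_compact:
  fixes T :: "'a::banach topology"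
  assumes T: "compatible_topology T" and A: "relatively_countably_compact_in T A"
  shows "relatively_sequentially_compact_in T A"
  unfolding relatively_sequentially_compact_in_def
proof (intro allI impI)
  fix s :: "nat \<Rightarrow> 'a"
  assume s: "range s \<subseteq> A"
  have top: "topspace T = UNIV" by (rule compatible_topology_topspace[OF T])
  obtain f :: "nat \<Rightarrow> 'a \<Rightarrow>\<^sub>L real" where f: "\<And>z. (\<And>e. 0 < e \<Longrightarrow> \<exists>y\<in>span (range s). norm (z - y) < e)
      \<Longrightarrow> (\<And>i. f i z = 0) \<Longrightarrow> z = 0"
    using countable_separating_functionals[of s] by metis
  obtain z where z: "cluster_point_in T s z"
    using A s unfolding relatively_countably_compact_in_def by blast
  \<comment> \<open>\<open>U j\<close> controls the first \<open>j\<close> functionals up to a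
    shrinking error, so one term from each \<open>U j\<close> makes all of them converge.\<close>
  define U where "U j = {y. (\<Sum>i<j. \<bar>f i y - f i z\<bar>) < inverse (real (Suc j))}" for j
  have "openin T (U j)" for j
    unfolding U_def
    by (intro openin_continuous_map_real_less top continuous_map_sum continuous_map_real_abs
        continuous_map_diff continuous_map_canonical_const compatible_topology_continuous[OF T]) auto
  moreover have "z \<in> U j" for j by (simp add: U_def)
  ultimately have freq: "\<exists>\<^sub>F n in sequentially. s n \<in> U j" for j
    using z by (auto simp: cluster_point_in_def)
  have "\<exists>r. \<forall>j. s (r j) \<in> U j \<and> r j < r (Suc j)"
  proof (rule dependent_nat_choice)
    show "\<exists>n. s n \<in> U 0" using frequently_ex[OF freq] .
    show "\<exists>n. s n \<in> U (Suc j) \<and> m < n" for m j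
      using freq[of "Suc j"] unfolding frequently_sequentially by (meson Suc_le_eq)
  qed
  then obtain r where r: "\<And>j. s (r j) \<in> U j" "strict_mono r"
    by (auto simp: strict_mono_Suc_iff)
  have lim: "(\<lambda>j. f i (s (r j))) \<longlonglongrightarrow> f i z" for i
  proof -
    have "\<forall>\<^sub>F j in sequentially. norm (f i (s (r j)) - f i z) \<le> inverse (real (Suc j))"
      using eventually_gt_at_top[of i]
    proof eventually_elim
      fix j
      assume "i < j"
      then have "\<bar>f i (s (r j)) - f i z\<bar> \<le> (\<Sum>i<j. \<bar>f i (s (r j)) - f i z\<bar>)"
        by (intro member_le_sum[where f = "\<lambda>i. \<bar>f i (s (r j)) - f i z\<bar>"]) auto
      with r(1)[of j] show "norm (f i (s (r j)) - f i z) \<le> inverse (real (Suc j))"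
        by (simp add: U_def)
    qed
    from Lim_null_comparison[OF this LIMSEQ_inverse_real_of_nat] show ?thesis
      by (simp add: LIM_zero_iff)
  qed
  have "limitin T (s \<circ> r) z sequentially"
    unfolding limitin_def
  proof (intro conjI allI impI)
    show "z \<in> topspace T" by (simp add: top)
    fix V
    assume V: "openin T V \<and> z \<in> V"
    show "\<forall>\<^sub>F j in sequentially. (s \<circ> r) j \<in> V"
    proof (rule ccontr)
      assume "\<not> ?thesis"
      \<comment> \<open>Without convergence some subsequence stays outside \<open>V\<close>; its
        cluster point will turn out to be \<open>z\<close>, which lies in \<open>V\<close>.\<close>
      then have "infinite {j. s (r j) \<notin> V}"
        by (simp add: frequently_cofinite[symmetric] cofinite_eq_sequentially frequently_def)
      then obtain q :: "nat \<Rightarrow> nat" where q: "strict_mono q" "\<And>m. s (r (q m)) \<notin> V"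
        using infinite_enumerate[of "{j. s (r j) \<notin> V}"] by auto
      define u where "u m = s (r (q m))" for m
      have u: "range u \<subseteq> range s" by (auto simp: u_def)
      with s obtain z' where z': "cluster_point_in T u z'"
        using A unfolding relatively_countably_compact_in_def by (meson order_trans)
      have lim': "(\<lambda>m. f i (u m)) \<longlonglongrightarrow> f i z" for i
        using LIMSEQ_subseq_LIMSEQ[OF lim q(1), of i] by (simp add: u_def o_def)
      have "f i (z' - z) = 0" for i
      proof -
        have "\<bar>f i z' - f i z\<bar> \<le> e" if e: "0 < e" for e
        proof -
          have "\<exists>\<^sub>F m in sequentially. \<bar>f i (u m) - f i z'\<bar> < e / 2"
            using e by (intro cluster_point_continuous_map[OF z' compatible_topology_continuous[OF T]]) simp
          moreover have "\<forall>\<^sub>F m in sequentially. \<bar>f i (u m) - f i z\<bar> < e / 2"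
            using tendstoD[OF lim', of "e / 2" i] e by (simp add: dist_real_def)
          ultimately obtain m where "\<bar>f i (u m) - f i z'\<bar> < e / 2" "\<bar>f i (u m) - f i z\<bar> < e / 2"
            by (metis (mono_tags, lifting) frequently_eventually_frequently frequently_ex)
          then show ?thesis by linarith
        qed
        then show ?thesis
          using dense_ge[of 0 "\<bar>f i z' - f i z\<bar>"] by (simp add: blinfun.diff_right)
      qed
      moreover have "\<exists>y\<in>span (range s). norm (z' - z - y) < e" if e: "0 < e" for e
      proof -
        have s_span: "range s \<subseteq> span (range s)" by (rule span_superset)
        obtain y' where y': "y' \<in> span (range s)" "norm (z' - y') < e / 2"
          using cluster_point_near_span[OF T z' _ subspace_span, of "range s" "e / 2"] u s_span e by auto
        obtain y where y: "y \<in> span (range s)" "norm (z - y) < e / 2"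
          using cluster_point_near_span[OF T z s_span subspace_span, of "e / 2"] e by auto
        have "norm (z' - z - (y' - y)) < e"
          using norm_triangle_ineq4[of "z' - y'" "z - y"] y' y by (simp add: algebra_simps)
        with span_diff[OF y'(1) y(1)] show ?thesis by blast
      qed
      ultimately have "z' = z" using f[of "z' - z"] by simp
      then have "\<exists>\<^sub>F m in sequentially. u m \<in> V"
        using z' V by (simp add: cluster_point_in_def)
      with q(2) show False by (simp add: u_def)
    qed
  qed
  with r(2) top show "\<exists>z\<in>topspace T. \<exists>r. strict_mono r \<and> limitin T (s \<circ> r) z sequentially"
    by blast
qed

theorem theorem4p5:
  fixes T :: "'a::banach topology" and A :: "'a set"
  assumes "compatible_topology T"
  shows "(relatively_compact_in T A \<longleftrightarrow> relatively_sequentially_compact_in T A) \<and>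
         (relatively_sequentially_compact_in T A \<longleftrightarrow> relatively_countably_compact_in T A) \<and>
         (relatively_countably_compact_in T A \<longleftrightarrow> topologically_bounded_in T A)"
proof -
  have "A \<subseteq> topspace T"
    by (simp add: compatible_topology_topspace[OF assms])
  \<comment> \<open>Compact implies countably compact, which implies bounded, which implies compact;
    sequential and countable compactness imply each other.\<close>
  note relatively_compact_imp_countably_compact[OF _ this]
    relatively_countably_compact_imp_sequentially_compact[OF assms, of A]
    relatively_sequentially_compact_imp_countably_compact[of T A]
    relatively_countably_compact_imp_topologically_bounded[of T A]
    topologically_bounded_imp_relatively_compact[OF assms, of A]
  then show ?thesis by satx
qed

end
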